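(* Let $A$ be a Hermitian matrix with algebraic entries and let $U(t)=\exp(itA)$. Let $D$ be a density matrix of the same size as $A$, and write $D(t)=U(t)DU(-t)$. If $D$ is algebraic and, for some real $t\neq 0$, the density matrix $D(t)$ is algebraic, then the ratio condition holds on the eigenvalue support of $D$.
   Context: A density matrix is a positive semidefinite (Hermitian) matrix with trace $1$; it is algebraic if all its entries are algebraic numbers. Let $A=\sum_r\theta_rE_r$ be the spectral decomposition of $A$, where the $\theta_r$ are the distinct eigenvalues of $A$ and $E_r$ is the matrix of orthogonal projection onto the $\theta_r$-eigenspace. The eigenvalue support of $D$ is the set of pairs $(\theta_r,\theta_s)$ such that $E_rDE_s\neq0$. The ratio condition holds on the eigenvalue support of $D$ if for any two pairs $(\theta_r,\theta_s)$ and $(\theta_k,\theta_\ell)$ in it with $\theta_k\neq\theta_\ell$ we have $\frac{\theta_r-\theta_s}{\theta_k-\theta_\ell}\in\mathbb{Q}$. *)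

theory Defs
  imports
    Jordan_Normal_Form.Schur_Decomposition
    Jordan_Normal_Form.Spectral_Radius
begin

definition hermitian_mat :: "complex mat \<Rightarrow> bool" where
  "hermitian_mat A \<longleftrightarrow> mat_adjoint A = A"

text \<open>The order on \<^typ>\<open>complex\<close> is that of \<^theory>\<open>HOL-Library.Complex_Order\<close>:
  \<open>0 \<le> z\<close> says that \<open>z\<close> is real and nonnegative.\<close>

definition positive_semidefinite_mat :: "complex mat \<Rightarrow> bool" where
  "positive_semidefinite_mat D \<longleftrightarrow>
     hermitian_mat D \<and> (\<forall>v \<in> carrier_vec (dim_row D). 0 \<le> (D *\<^sub>v v) \<bullet>c v)"

definition mat_trace :: "complex mat \<Rightarrow> complex" where
  "mat_trace M = (\<Sum>i < dim_row M. M $$ (i, i))"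

definition density_mat :: "complex mat \<Rightarrow> bool" where
  "density_mat D \<longleftrightarrow> positive_semidefinite_mat D \<and> mat_trace D = 1"

definition algebraic_mat :: "complex mat \<Rightarrow> bool" where
  "algebraic_mat M \<longleftrightarrow> (\<forall>i < dim_row M. \<forall>j < dim_col M. algebraic (M $$ (i, j)))"

text \<open>Matrices carry no topology here, so the exponential series is summed entrywise;
  it always converges, see \<open>summable_mat_exp\<close> below.\<close>

definition mat_exp :: "complex mat \<Rightarrow> complex mat" where
  "mat_exp M = mat (dim_row M) (dim_row M) (\<lambda>(i, j). \<Sum>k. (M ^\<^sub>m k) $$ (i, j) / fact k)"

definition transition_mat :: "complex mat \<Rightarrow> real \<Rightarrow> complex mat" where
  "transition_mat A t = mat_exp ((\<i> * complex_of_real t) \<cdot>\<^sub>m A)"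

definition state_at :: "complex mat \<Rightarrow> complex mat \<Rightarrow> real \<Rightarrow> complex mat" where
  "state_at A D t = transition_mat A t * D * transition_mat A (- t)"

definition eigenspace :: "complex mat \<Rightarrow> complex \<Rightarrow> complex vec set" where
  "eigenspace A \<theta> = {v \<in> carrier_vec (dim_row A). A *\<^sub>v v = \<theta> \<cdot>\<^sub>v v}"

definition is_orthogonal_projection :: "nat \<Rightarrow> complex vec set \<Rightarrow> complex mat \<Rightarrow> bool" where
  "is_orthogonal_projection n W P \<longleftrightarrow> P \<in> carrier_mat n n \<and>
     (\<forall>v \<in> carrier_vec n. P *\<^sub>v v \<in> W \<and> (\<forall>w \<in> W. (v - P *\<^sub>v v) \<bullet>c w = 0))"

text \<open>The description is proper for every square matrix, see
  \<open>is_orthogonal_projection_eigenprojection\<close> below.\<close>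

definition eigenprojection :: "complex mat \<Rightarrow> complex \<Rightarrow> complex mat" where
  "eigenprojection A \<theta> = (THE P. is_orthogonal_projection (dim_row A) (eigenspace A \<theta>) P)"

definition eigenvalue_support :: "complex mat \<Rightarrow> complex mat \<Rightarrow> (complex \<times> complex) set" where
  "eigenvalue_support A D =
     {(\<theta>, \<eta>). eigenvalue A \<theta> \<and> eigenvalue A \<eta> \<and>
        eigenprojection A \<theta> * D * eigenprojection A \<eta> \<noteq> 0\<^sub>m (dim_row A) (dim_row A)}"

definition ratio_condition :: "(complex \<times> complex) set \<Rightarrow> bool" where
  "ratio_condition S \<longleftrightarrow>
     (\<forall>(\<theta>\<^sub>r, \<theta>\<^sub>s) \<in> S. \<forall>(\<theta>\<^sub>k, \<theta>\<^sub>l) \<in> S. \<theta>\<^sub>k \<noteq> \<theta>\<^sub>l \<longrightarrow> (\<theta>\<^sub>r - \<theta>\<^sub>s) / (\<theta>\<^sub>k - \<theta>\<^sub>l) \<in> \<rat>)"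


subsection \<open>Convergence of the exponential series\<close>

lemma summable_mat_exp:
  fixes M :: "complex mat"
  assumes M: "M \<in> carrier_mat n n" and i: "i < n" and j: "j < n"
  shows "summable (\<lambda>k. (M ^\<^sub>m k) $$ (i, j) / fact k)"
proof -
  obtain b where b: "norm_bound M b" using norm_bound_max[of M] by blast
  define c where "c = b * of_nat n"
  have bd: "norm_bound (M ^\<^sub>m k) (c ^ k)" for k
  proof (induction k)
    case 0
    show ?case using M by (auto simp: norm_bound_def)
  next
    case (Suc k)
    have "M ^\<^sub>m k \<in> carrier_mat n n" using M by simp
    from norm_bound_mult[OF this M Suc.IH b]
    have "norm_bound (M ^\<^sub>m k * M) (c ^ k * b * of_nat n)" .
    moreover have "c ^ k * b * of_nat n = c ^ Suc k" by (simp add: c_def)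
    ultimately show ?case by simp
  qed
  have "summable (\<lambda>k. inverse (fact k) * c ^ k)" by (rule summable_exp)
  moreover have "norm ((M ^\<^sub>m k) $$ (i, j) / fact k) \<le> inverse (fact k) * c ^ k" for k
    using bd[of k] i j M
    by (auto simp: norm_bound_def norm_divide field_simps)
  ultimately show ?thesis by (rule summable_comparison_test'[where N = 0])
qed


subsection \<open>Existence and uniqueness of orthogonal projections\<close>

lemma cscalar_prod_eq_sum:
  assumes "w \<in> carrier_vec n"
  shows "(v :: complex vec) \<bullet>c w = (\<Sum>i < n. v $ i * cnj (w $ i))"
  using assms by (auto simp: scalar_prod_def lessThan_atLeast0 intro!: sum.cong)

lemma corthogonal_length_le:
  fixes us :: "complex vec list"
  assumes us: "corthogonal us" "set us \<subseteq> carrier_vec n"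
  shows "length us \<le> n"
proof (rule ccontr)
  assume "\<not> length us \<le> n"
  then have n: "n < length us" by simp
  define l where "l = length us"
  have el: "us ! k \<in> carrier_vec n" if "k < l" for k
    using that us(2) by (auto simp: l_def)
  define V where "V = mat l l (\<lambda>(i, k). if i < n then us ! k $ i else 0)"
  define W where
    "W = mat l l (\<lambda>(k, i). if i < n then cnj (us ! k $ i) / (us ! k \<bullet>c us ! k) else 0)"
  have VW: "V \<in> carrier_mat l l" "W \<in> carrier_mat l l" by (auto simp: V_def W_def)
  have "W * V = 1\<^sub>m l"
  proof (rule eq_matI)
    fix k m assume "k < dim_row (1\<^sub>m l :: complex mat)" "m < dim_col (1\<^sub>m l :: complex mat)"
    then have k: "k < l" and m: "m < l" by auto
    have "(W * V) $$ (k, m) =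
        (\<Sum>i < l. if i < n then us ! m $ i * cnj (us ! k $ i) / (us ! k \<bullet>c us ! k) else 0)"
      using k m by (auto simp: V_def W_def scalar_prod_def lessThan_atLeast0 intro!: sum.cong)
    also have "\<dots> = (\<Sum>i < n. us ! m $ i * cnj (us ! k $ i) / (us ! k \<bullet>c us ! k))"
      using n by (intro sum.mono_neutral_cong_right) (auto simp: l_def)
    also have "\<dots> = (us ! m \<bullet>c us ! k) / (us ! k \<bullet>c us ! k)"
      using cscalar_prod_eq_sum[OF el[OF k], of "us ! m"] by (simp add: sum_divide_distrib)
    also have "\<dots> = (1\<^sub>m l :: complex mat) $$ (k, m)"
      using corthogonalD[OF us(1), of m k] corthogonalD[OF us(1), of k k] k m
      by (auto simp: l_def)
    finally show "(W * V) $$ (k, m) = (1\<^sub>m l :: complex mat) $$ (k, m)" .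
  qed (auto simp: V_def W_def)
  then have "V * W = 1\<^sub>m l" by (rule mat_mult_left_right_inverse[OF VW(2,1)])
  then have "(V * W) $$ (n, n) = 1" using n by (simp add: l_def)
  moreover have "(V * W) $$ (n, n) = 0"
    using n by (auto simp: V_def W_def scalar_prod_def l_def)
  ultimately show False by simp
qed

lemma orthogonal_projection_exists:
  fixes W :: "complex vec set"
  assumes W: "W \<subseteq> carrier_vec n" and zero: "0\<^sub>v n \<in> W"
    and add: "\<And>v w. v \<in> W \<Longrightarrow> w \<in> W \<Longrightarrow> v + w \<in> W"
    and smult: "\<And>c v. v \<in> W \<Longrightarrow> c \<cdot>\<^sub>v v \<in> W"
  shows "\<exists>P. is_orthogonal_projection n W P"
proof -
  let ?ok = "\<lambda>us. corthogonal us \<and> set us \<subseteq> W"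
  have "?ok []" by auto
  moreover have "\<forall>us. ?ok us \<longrightarrow> length us < Suc n"
    using corthogonal_length_le W by (metis le_imp_less_Suc subset_trans)
  ultimately obtain us where ok: "?ok us" and max: "\<And>vs. ?ok vs \<Longrightarrow> length vs \<le> length us"
    using ex_has_greatest_nat[of ?ok "[]" length "Suc n"] by blast
  define l where "l = length us"
  have elW: "us ! k \<in> W" if "k < l" for k using that ok by (auto simp: l_def)
  have el: "us ! k \<in> carrier_vec n" if "k < l" for k using elW[OF that] W by auto
  have orth: "us ! k \<bullet>c us ! m = 0 \<longleftrightarrow> k \<noteq> m" if "k < l" "m < l" for k m
    using that ok corthogonalD by (auto simp: l_def)
  define c where "c v k = (v \<bullet>c us ! k) / (us ! k \<bullet>c us ! k)" for v k
  define P where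
    "P = mat n n (\<lambda>(i, j). \<Sum>k<l. us ! k $ i * cnj (us ! k $ j) / (us ! k \<bullet>c us ! k))"
  have P: "P \<in> carrier_mat n n" by (simp add: P_def)
  have Pv: "P *\<^sub>v v = vec n (\<lambda>i. \<Sum>k<l. c v k * us ! k $ i)" if v: "v \<in> carrier_vec n" for v
  proof (rule eq_vecI)
    fix i assume "i < dim_vec (vec n (\<lambda>i. \<Sum>k<l. c v k * us ! k $ i))"
    then have i: "i < n" by simp
    have "(P *\<^sub>v v) $ i =
        (\<Sum>j<n. (\<Sum>k<l. us ! k $ i * cnj (us ! k $ j) / (us ! k \<bullet>c us ! k)) * v $ j)"
      using i v by (auto simp: P_def scalar_prod_def lessThan_atLeast0 intro!: sum.cong)
    also have "\<dots> =
        (\<Sum>k<l. \<Sum>j<n. us ! k $ i * cnj (us ! k $ j) / (us ! k \<bullet>c us ! k) * v $ j)"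
      unfolding sum_distrib_right by (rule sum.swap)
    also have "\<dots> = (\<Sum>k<l. c v k * us ! k $ i)"
    proof (rule sum.cong[OF refl])
      fix k assume "k \<in> {..<l}"
      then have "k < l" by simp
      then have "us ! k \<in> carrier_vec n" by (rule el)
      then have e: "(v \<bullet>c us ! k) = (\<Sum>j<n. v $ j * cnj (us ! k $ j))"
        by (rule cscalar_prod_eq_sum)
      define d where "d = us ! k \<bullet>c us ! k"
      have "(\<Sum>j<n. us ! k $ i * cnj (us ! k $ j) / d * v $ j) =
          (\<Sum>j<n. us ! k $ i / d * (v $ j * cnj (us ! k $ j)))"
        by (intro sum.cong refl) (simp add: field_simps)
      also have "\<dots> = us ! k $ i / d * (v \<bullet>c us ! k)"
        unfolding e by (rule sum_distrib_left [symmetric])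
      finally show "(\<Sum>j<n. us ! k $ i * cnj (us ! k $ j) / (us ! k \<bullet>c us ! k) * v $ j) = c v k * us ! k $ i"
        by (simp add: c_def d_def)
    qed
    finally show "(P *\<^sub>v v) $ i = vec n (\<lambda>i. \<Sum>k<l. c v k * us ! k $ i) $ i" using i by simp
  qed (simp add: P_def)
  have comb: "vec n (\<lambda>i. \<Sum>k<m. a k * us ! k $ i) \<in> W" if "m \<le> l" for m a
    using that
  proof (induction m)
    case 0
    have "vec n (\<lambda>i. \<Sum>k<0. a k * us ! k $ i) = 0\<^sub>v n" by auto
    then show ?case using zero by simp
  next
    case (Suc m)
    have "vec n (\<lambda>i. \<Sum>k<Suc m. a k * us ! k $ i) =
        vec n (\<lambda>i. \<Sum>k<m. a k * us ! k $ i) + a m \<cdot>\<^sub>v us ! m"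
      using el[of m] Suc.prems by auto
    then show ?case using Suc add smult elW by simp
  qed
  have PW: "P *\<^sub>v v \<in> W" if "v \<in> carrier_vec n" for v
    using Pv[OF that] comb[of l] by simp
  have Porth: "(v - P *\<^sub>v v) \<bullet>c us ! m = 0" if v: "v \<in> carrier_vec n" and m: "m < l" for v m
  proof -
    have "(P *\<^sub>v v) \<bullet>c us ! m = (\<Sum>i<n. (\<Sum>k<l. c v k * us ! k $ i) * cnj (us ! m $ i))"
      unfolding cscalar_prod_eq_sum[OF el[OF m]] Pv[OF v] by simp
    also have "\<dots> = (\<Sum>k<l. \<Sum>i<n. c v k * us ! k $ i * cnj (us ! m $ i))"
      unfolding sum_distrib_right by (rule sum.swap)
    also have "\<dots> = (\<Sum>k<l. c v k * (us ! k \<bullet>c us ! m))"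
      unfolding cscalar_prod_eq_sum[OF el[OF m]] by (simp add: sum_distrib_left mult.assoc)
    also have "\<dots> = (\<Sum>k<l. if k = m then c v m * (us ! m \<bullet>c us ! m) else 0)"
      using orth m by (intro sum.cong) auto
    also have "\<dots> = v \<bullet>c us ! m" using m orth[OF m m] by (simp add: c_def)
    finally have "(P *\<^sub>v v) \<bullet>c us ! m = v \<bullet>c us ! m" .
    then show ?thesis
      using v P el[OF m] by (subst minus_scalar_prod_distrib[of _ n]) auto
  qed
  have fixW: "P *\<^sub>v w = w" if w: "w \<in> W" for w
  proof (rule ccontr)
    assume neq: "P *\<^sub>v w \<noteq> w"
    have wc: "w \<in> carrier_vec n" using w W by auto
    have Pwc: "P *\<^sub>v w \<in> carrier_vec n" using PW[OF wc] W by auto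
    define x where "x = w - P *\<^sub>v w"
    have xc: "x \<in> carrier_vec n" using wc Pwc by (simp add: x_def)
    have "x = w + (-1) \<cdot>\<^sub>v (P *\<^sub>v w)" using wc Pwc by (auto simp: x_def)
    then have xW: "x \<in> W" using add smult w PW[OF wc] by simp
    have "x \<noteq> 0\<^sub>v n"
    proof
      assume x0: "x = 0\<^sub>v n"
      have "P *\<^sub>v w = w"
      proof (rule eq_vecI)
        fix i assume i: "i < dim_vec w"
        have "x $ i = 0" using i wc x0 by simp
        moreover have "x $ i = w $ i - (P *\<^sub>v w) $ i"
          unfolding x_def using i wc Pwc P by (intro index_minus_vec(1)) auto
        ultimately show "(P *\<^sub>v w) $ i = w $ i"
          by (simp del: index_mult_mat_vec)
      qed (use wc P in auto)
      then show False using neq by simp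
    qed
    then have xx: "x \<bullet>c x \<noteq> 0" using conjugate_square_eq_0_vec[OF xc] by simp
    have xu: "x \<bullet>c us ! m = 0" if "m < l" for m
      using Porth[OF wc that] by (simp add: x_def)
    have ux: "us ! m \<bullet>c x = 0" if "m < l" for m
    proof -
      have "us ! m \<bullet>c x = cnj (x \<bullet>c us ! m)"
        unfolding cscalar_prod_eq_sum[OF xc] cscalar_prod_eq_sum[OF el[OF that]]
        by (simp add: mult.commute)
      then show ?thesis using xu[OF that] by simp
    qed
    have "corthogonal (us @ [x])"
    proof (rule corthogonalI)
      fix i j assume "i < length (us @ [x])" "j < length (us @ [x])"
      then have "i < l \<or> i = l" "j < l \<or> j = l" by (auto simp: l_def)
      then show "((us @ [x]) ! i \<bullet>c (us @ [x]) ! j = 0) = (i \<noteq> j)"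
        using xx xu ux orth by (auto simp: nth_append l_def)
    qed
    then have "length (us @ [x]) \<le> length us" using ok xW by (intro max) auto
    then show False by simp
  qed
  have "(v - P *\<^sub>v v) \<bullet>c w = 0" if v: "v \<in> carrier_vec n" and w: "w \<in> W" for v w
  proof -
    have wc: "w \<in> carrier_vec n" using w W by auto
    let ?y = "v - P *\<^sub>v v"
    have "?y \<bullet>c w = (\<Sum>i<n. ?y $ i * cnj (\<Sum>k<l. c w k * us ! k $ i))"
      unfolding cscalar_prod_eq_sum[OF wc]
      by (intro sum.cong refl) (subst (1) fixW[OF w, symmetric], simp add: Pv[OF wc])
    also have "\<dots> = (\<Sum>k<l. cnj (c w k) * (\<Sum>i<n. ?y $ i * cnj (us ! k $ i)))"
      unfolding cnj_sum sum_distrib_left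
      by (subst sum.swap) (simp add: mult_ac)
    also have "\<dots> = 0"
      using Porth[OF v] cscalar_prod_eq_sum[OF el, of _ ?y] by (intro sum.neutral) auto
    finally show ?thesis .
  qed
  then show ?thesis using P PW unfolding is_orthogonal_projection_def by blast
qed

lemma orthogonal_projection_unique:
  fixes W :: "complex vec set"
  assumes W: "W \<subseteq> carrier_vec n"
    and add: "\<And>v w. v \<in> W \<Longrightarrow> w \<in> W \<Longrightarrow> v + w \<in> W"
    and smult: "\<And>c v. v \<in> W \<Longrightarrow> c \<cdot>\<^sub>v v \<in> W"
    and P: "is_orthogonal_projection n W P" and Q: "is_orthogonal_projection n W Q"
  shows "P = Q"
proof -
  have Pc: "P \<in> carrier_mat n n" and Qc: "Q \<in> carrier_mat n n"
    using P Q by (auto simp: is_orthogonal_projection_def)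
  have eq: "P *\<^sub>v v = Q *\<^sub>v v" if v: "v \<in> carrier_vec n" for v
  proof -
    have PW: "P *\<^sub>v v \<in> W" and QW: "Q *\<^sub>v v \<in> W"
      using P Q v by (auto simp: is_orthogonal_projection_def)
    have c: "P *\<^sub>v v \<in> carrier_vec n" "Q *\<^sub>v v \<in> carrier_vec n" using PW QW W by auto
    define x where "x = P *\<^sub>v v - Q *\<^sub>v v"
    have xc: "x \<in> carrier_vec n" using c by (simp add: x_def)
    have "x = P *\<^sub>v v + (-1) \<cdot>\<^sub>v (Q *\<^sub>v v)" using c by (auto simp: x_def)
    then have xW: "x \<in> W" using add smult PW QW by simp
    have 0: "(v - P *\<^sub>v v) \<bullet>c x = 0" "(v - Q *\<^sub>v v) \<bullet>c x = 0"
      using P Q v xW by (auto simp: is_orthogonal_projection_def)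
    have "x = (v - Q *\<^sub>v v) - (v - P *\<^sub>v v)" using c v Pc Qc by (auto simp: x_def)
    then have "x \<bullet>c x = (v - Q *\<^sub>v v) \<bullet>c x - (v - P *\<^sub>v v) \<bullet>c x"
      using c v xc by (metis carrier_vec_conjugate minus_carrier_vec minus_scalar_prod_distrib)
    then have "x = 0\<^sub>v n" using 0 conjugate_square_eq_0_vec[OF xc] by simp
    then have "(P *\<^sub>v v) $ i - (Q *\<^sub>v v) $ i = 0" if "i < n" for i
      using that c by (metis x_def carrier_vecD index_minus_vec(1) index_zero_vec(1))
    moreover have "dim_vec (P *\<^sub>v v) = n" "dim_vec (Q *\<^sub>v v) = n" using c by (auto dest: carrier_vecD)
    ultimately show ?thesis by (intro eq_vecI) (simp_all del: index_mult_mat_vec dim_mult_mat_vec)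
  qed
  show ?thesis
  proof (rule eq_matI)
    fix i j assume "i < dim_row Q" "j < dim_col Q"
    then have i: "i < n" and j: "j < n" using Qc by auto
    have "(P *\<^sub>v unit_vec n j) $ i = (Q *\<^sub>v unit_vec n j) $ i" using eq by simp
    then show "P $$ (i, j) = Q $$ (i, j)" using i j Pc Qc by simp
  qed (use Pc Qc in auto)
qed

lemma is_orthogonal_projection_eigenprojection:
  assumes A: "A \<in> carrier_mat n n"
  shows "is_orthogonal_projection n (eigenspace A \<theta>) (eigenprojection A \<theta>)"
proof -
  let ?W = "eigenspace A \<theta>"
  have W: "?W \<subseteq> carrier_vec n" using A by (auto simp: eigenspace_def)
  have zero: "0\<^sub>v n \<in> ?W" using A by (auto simp: eigenspace_def)
  have add: "v + w \<in> ?W" if "v \<in> ?W" "w \<in> ?W" for v w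
    using that A by (auto simp: eigenspace_def mult_add_distrib_mat_vec[OF A] smult_add_distrib_vec[of _ n])
  have smult: "c \<cdot>\<^sub>v v \<in> ?W" if "v \<in> ?W" for c v
    using that A by (auto simp: eigenspace_def mult_mat_vec[OF A] smult_smult_assoc mult.commute)
  have "\<exists>!P. is_orthogonal_projection n ?W P"
    using orthogonal_projection_exists[OF W zero add smult]
      orthogonal_projection_unique[OF W add smult] by blast
  then show ?thesis using A theI'[of "is_orthogonal_projection n ?W"]
    by (auto simp: eigenprojection_def)
qed

end

theory Submission
  imports "HOL-Complex_Analysis.Conformal_Mappings" Defs
begin

text \<open> Let \<open>E\<close> and \<open>F\<close> be the projections to the eigenspaces of
  \<open>\<theta>\<close> and \<open>\<eta>\<close>. Then \<open>E * D(t) * F = exp (\<i> t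
  (\<theta> - \<eta>)) * (E * D * F)\<close> (\<open>eigenprojection_state_at\<close>). The
  eigenvalues and the eigenprojections of an algebraic Hermitian matrix are algebraic
  (\<open>algebraic_eigenvalue\<close>, \<open>algebraic_eigenprojection\<close>). If \<open>E * D *
  F\<close> has a nonzero entry, the phase \<open>exp (\<i> t (\<theta> - \<eta>))\<close> is
  therefore a quotient of algebraic numbers (\<open>algebraic_phase\<close>). For two pairs in the
  support put \<open>\<omega> = \<i> t (\<theta>\<^sub>k - \<theta>\<^sub>l)\<close> and let
  \<open>\<beta>\<close> be the ratio \<open>(\<theta>\<^sub>r - \<theta>\<^sub>s) /
  (\<theta>\<^sub>k - \<theta>\<^sub>l)\<close>. Then \<open>\<beta>\<close>, \<open>exp
  \<omega>\<close> and \<open>exp (\<omega> * \<beta>)\<close> are algebraic and \<open>\<omega>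
  \<noteq> 0\<close>, so \<open>\<beta>\<close> is rational by the Gelfond-Schneider theorem
  (\<open>gelfond_schneider\<close>).

  The Gelfond-Schneider theorem is proved by Gelfond's method. If \<open>\<beta>\<close> were
  irrational, a pigeonhole argument (\<open>siegel_lemma\<close>) would provide an exponential sum
  \<open>F z = (\<Sum>j l. x j l * exp (\<omega> * (j + l * \<beta>) * z))\<close> with small
  integer coefficients \<open>x j l\<close>, not all zero, that vanishes to high order at the first
  few natural numbers. Among the derivatives of \<open>F\<close> that are nonzero at one of these
  points, take one of least order. Its value there is small by the maximum modulus principle
  (\<open>schwarz_lemma_many_zeros\<close>). On the other hand this value is, up to a power of
  \<open>\<omega>\<close>, a nonzero algebraic number of controlled size, so Liouville's inequality
  (\<open>norm_multiplier_ge\<close>) bounds it from below. For large parameters the two bounds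
  contradict each other.

  The arithmetic is carried out without number fields. Finitely many algebraic numbers act by
  multiplication, after scaling by an integer, on the \<open>\<int>\<close>-span of a finite set of
  complex numbers, hence through integer matrices. Sizes are measured by row sums of these matrices,
  integer linear equations arise by comparing coordinates, and the characteristic polynomial yields
  both algebraicity and Liouville's inequality. \<close>

no_notation fps_nth (infixl "$" 75)
no_notation vec_nth (infixl "$" 90)

section \<open>Modules of complex numbers and their integral multipliers\<close>

definition zspan :: "complex set \<Rightarrow> complex set" where
  "zspan X = range (\<lambda>c :: complex \<Rightarrow> int. \<Sum>b\<in>X. of_int (c b) * b)"

lemma zspanI: "x = (\<Sum>b\<in>X. of_int (c b) * b) \<Longrightarrow> x \<in> zspan X"
  unfolding zspan_def by auto

lemma zspanE:
  assumes "x \<in> zspan X"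
  obtains c where "x = (\<Sum>b\<in>X. of_int (c b) * b)"
  using assms unfolding zspan_def by auto

lemma zspan_base:
  assumes "finite X" "b \<in> X"
  shows "b \<in> zspan X"
proof (rule zspanI)
  have "(\<Sum>b'\<in>X. of_int (if b' = b then 1 else 0) * b') = (\<Sum>b'\<in>X. if b' = b then b' else 0)"
    by (intro sum.cong) auto
  then show "b = (\<Sum>b'\<in>X. of_int (if b' = b then 1 else 0) * b')"
    using assms by simp
qed

lemma zspan_zero: "0 \<in> zspan X"
  by (rule zspanI[where c = "\<lambda>_. 0"]) simp

lemma zspan_add: "x \<in> zspan X \<Longrightarrow> y \<in> zspan X \<Longrightarrow> x + y \<in> zspan X"
  by (elim zspanE, rule zspanI[where c = "\<lambda>b. _ b + _ b"])
     (simp add: ring_distribs sum.distrib)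

lemma zspan_of_int_mult: "x \<in> zspan X \<Longrightarrow> of_int k * x \<in> zspan X"
  by (elim zspanE, rule zspanI[where c = "\<lambda>b. k * _ b"])
     (simp add: sum_distrib_left mult.assoc)

lemma zspan_sum: "(\<And>i. i \<in> I \<Longrightarrow> f i \<in> zspan X) \<Longrightarrow> sum f I \<in> zspan X"
  by (induction I rule: infinite_finite_induct) (auto intro: zspan_zero zspan_add)

lemma zspan_mult_left:
  assumes "\<And>b. b \<in> X \<Longrightarrow> y * b \<in> zspan Y" and "x \<in> zspan X"
  shows "y * x \<in> zspan Y"
proof -
  obtain c where "x = (\<Sum>b\<in>X. of_int (c b) * b)" using assms(2) by (rule zspanE)
  then have "y * x = (\<Sum>b\<in>X. of_int (c b) * (y * b))"
    by (simp add: sum_distrib_left algebra_simps)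
  then show ?thesis using assms(1) by (auto intro!: zspan_sum zspan_of_int_mult)
qed

definition multiplier :: "complex set \<Rightarrow> complex \<Rightarrow> bool" where
  "multiplier X y \<longleftrightarrow> (\<forall>b\<in>X. y * b \<in> zspan X)"

text \<open>The bound \<open>B\<close> is on the maximal row sum of an integer matrix that
  represents multiplication by \<open>y\<close> on the span of \<open>X\<close>. The elements of
  \<open>X\<close> may be linearly dependent, so \<open>y\<close> does not determine the matrix. The
  maximal row sum is submultiplicative, which makes the bounds of the arithmetic below immediate,
  and it dominates every eigenvalue.\<close>

definition multiplier_norm_le :: "complex set \<Rightarrow> real \<Rightarrow> complex \<Rightarrow> bool" where
  "multiplier_norm_le X B y \<longleftrightarrow> (\<exists>M :: complex \<Rightarrow> complex \<Rightarrow> int. \<forall>b\<in>X.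
     y * b = (\<Sum>b'\<in>X. of_int (M b b') * b') \<and> (\<Sum>b'\<in>X. \<bar>real_of_int (M b b')\<bar>) \<le> B)"

lemma multiplier_norm_leI:
  assumes "\<And>b. b \<in> X \<Longrightarrow> y * b = (\<Sum>b'\<in>X. of_int (M b b') * b')"
    and "\<And>b. b \<in> X \<Longrightarrow> (\<Sum>b'\<in>X. \<bar>real_of_int (M b b')\<bar>) \<le> B"
  shows "multiplier_norm_le X B y"
  using assms unfolding multiplier_norm_le_def by blast

lemma multiplier_imp_norm_le:
  assumes "finite X" "multiplier X y"
  obtains B where "multiplier_norm_le X B y"
proof -
  have "\<forall>b\<in>X. \<exists>c :: complex \<Rightarrow> int. y * b = (\<Sum>b'\<in>X. of_int (c b') * b')"
    using assms(2) unfolding multiplier_def by (blast elim: zspanE)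
  then obtain M :: "complex \<Rightarrow> complex \<Rightarrow> int"
    where M: "\<And>b. b \<in> X \<Longrightarrow> y * b = (\<Sum>b'\<in>X. of_int (M b b') * b')" by metis
  show ?thesis
  proof
    show "multiplier_norm_le X (\<Sum>b\<in>X. \<Sum>b'\<in>X. \<bar>real_of_int (M b b')\<bar>) y"
      using M assms(1) by (intro multiplier_norm_leI[where M = M])
        (auto intro!: member_le_sum sum_nonneg)
  qed
qed

lemma multiplier_norm_le_mono:
  assumes "multiplier_norm_le X B y" "B \<le> C"
  shows "multiplier_norm_le X C y"
proof -
  obtain M where M: "\<And>b. b \<in> X \<Longrightarrow> y * b = (\<Sum>b'\<in>X. of_int (M b b') * b')"
    "\<And>b. b \<in> X \<Longrightarrow> (\<Sum>b'\<in>X. \<bar>real_of_int (M b b')\<bar>) \<le> B"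
    using assms(1) unfolding multiplier_norm_le_def by blast
  show ?thesis
    using M(1) order_trans[OF M(2) assms(2)] by (rule multiplier_norm_leI)
qed

lemma multiplier_norm_le_of_int:
  assumes "finite X"
  shows "multiplier_norm_le X \<bar>of_int k\<bar> (of_int k)"
proof (rule multiplier_norm_leI[where M = "\<lambda>b b'. if b' = b then k else 0"])
  fix b assume b: "b \<in> X"
  have "(\<Sum>b'\<in>X. of_int (if b' = b then k else 0) * b')
      = (\<Sum>b'\<in>X. if b' = b then of_int k * b' else 0)"
    by (intro sum.cong) auto
  then show "of_int k * b = (\<Sum>b'\<in>X. of_int (if b' = b then k else 0) * b')"
    using assms b by simp
  have "(\<Sum>b'\<in>X. \<bar>real_of_int (if b' = b then k else 0)\<bar>)
      = (\<Sum>b'\<in>X. if b' = b then \<bar>of_int k\<bar> else 0)"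
    by (intro sum.cong) auto
  then show "(\<Sum>b'\<in>X. \<bar>real_of_int (if b' = b then k else 0)\<bar>) \<le> \<bar>of_int k\<bar>"
    using assms b by simp
qed

lemma multiplier_norm_le_add:
  assumes "multiplier_norm_le X B x" "multiplier_norm_le X C y"
  shows "multiplier_norm_le X (B + C) (x + y)"
proof -
  obtain M where M: "\<And>b. b \<in> X \<Longrightarrow> x * b = (\<Sum>b'\<in>X. of_int (M b b') * b')"
    "\<And>b. b \<in> X \<Longrightarrow> (\<Sum>b'\<in>X. \<bar>real_of_int (M b b')\<bar>) \<le> B"
    using assms(1) unfolding multiplier_norm_le_def by blast
  obtain N where N: "\<And>b. b \<in> X \<Longrightarrow> y * b = (\<Sum>b'\<in>X. of_int (N b b') * b')"
    "\<And>b. b \<in> X \<Longrightarrow> (\<Sum>b'\<in>X. \<bar>real_of_int (N b b')\<bar>) \<le> C"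
    using assms(2) unfolding multiplier_norm_le_def by blast
  show ?thesis
  proof (rule multiplier_norm_leI[where M = "\<lambda>b b'. M b b' + N b b'"])
    fix b assume b: "b \<in> X"
    show "(x + y) * b = (\<Sum>b'\<in>X. of_int (M b b' + N b b') * b')"
      using M(1)[OF b] N(1)[OF b] by (simp add: ring_distribs sum.distrib)
    have "(\<Sum>b'\<in>X. \<bar>real_of_int (M b b' + N b b')\<bar>)
        \<le> (\<Sum>b'\<in>X. \<bar>real_of_int (M b b')\<bar> + \<bar>real_of_int (N b b')\<bar>)"
      by (intro sum_mono) auto
    also have "\<dots> \<le> B + C" using M(2)[OF b] N(2)[OF b] by (simp add: sum.distrib)
    finally show "(\<Sum>b'\<in>X. \<bar>real_of_int (M b b' + N b b')\<bar>) \<le> B + C" .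
  qed
qed

lemma multiplier_norm_le_mult:
  assumes "multiplier_norm_le X B x" "multiplier_norm_le X C y" "B \<ge> 0"
  shows "multiplier_norm_le X (B * C) (x * y)"
proof -
  obtain M where M: "\<And>b. b \<in> X \<Longrightarrow> x * b = (\<Sum>b'\<in>X. of_int (M b b') * b')"
    "\<And>b. b \<in> X \<Longrightarrow> (\<Sum>b'\<in>X. \<bar>real_of_int (M b b')\<bar>) \<le> B"
    using assms(1) unfolding multiplier_norm_le_def by blast
  obtain N where N: "\<And>b. b \<in> X \<Longrightarrow> y * b = (\<Sum>b'\<in>X. of_int (N b b') * b')"
    "\<And>b. b \<in> X \<Longrightarrow> (\<Sum>b'\<in>X. \<bar>real_of_int (N b b')\<bar>) \<le> C"
    using assms(2) unfolding multiplier_norm_le_def by blast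
  show ?thesis
  proof (rule multiplier_norm_leI[where M = "\<lambda>b b''. \<Sum>b'\<in>X. M b' b'' * N b b'"])
    fix b assume b: "b \<in> X"
    have "x * y * b = (\<Sum>b'\<in>X. of_int (N b b') * (x * b'))"
      unfolding mult.assoc N(1)[OF b] by (simp add: sum_distrib_left mult.left_commute)
    also have "\<dots> = (\<Sum>b'\<in>X. of_int (N b b') * (\<Sum>b''\<in>X. of_int (M b' b'') * b''))"
      using M(1) by (intro sum.cong refl) auto
    also have "\<dots> = (\<Sum>b''\<in>X. of_int (\<Sum>b'\<in>X. M b' b'' * N b b') * b'')"
      by (simp add: sum_distrib_left sum_distrib_right algebra_simps) (rule sum.swap)
    finally show "x * y * b = \<dots>" .
    have "(\<Sum>b''\<in>X. \<bar>real_of_int (\<Sum>b'\<in>X. M b' b'' * N b b')\<bar>)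
        \<le> (\<Sum>b''\<in>X. \<Sum>b'\<in>X. \<bar>real_of_int (M b' b'')\<bar> * \<bar>real_of_int (N b b')\<bar>)"
      by (intro sum_mono) (auto simp: abs_mult[symmetric] intro: order_trans[OF sum_abs])
    also have "\<dots> = (\<Sum>b'\<in>X. (\<Sum>b''\<in>X. \<bar>real_of_int (M b' b'')\<bar>) * \<bar>real_of_int (N b b')\<bar>)"
      by (subst sum.swap) (simp add: sum_distrib_right)
    also have "\<dots> \<le> (\<Sum>b'\<in>X. B * \<bar>real_of_int (N b b')\<bar>)"
      using M(2) by (intro sum_mono mult_right_mono) auto
    also have "\<dots> \<le> B * C" using N(2)[OF b] assms(3)
      by (simp add: sum_distrib_left[symmetric] mult_left_mono)
    finally show "(\<Sum>b''\<in>X. \<bar>real_of_int (\<Sum>b'\<in>X. M b' b'' * N b b')\<bar>) \<le> B * C" .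
  qed
qed

lemma multiplier_norm_le_power:
  assumes "finite X" "multiplier_norm_le X B x" "B \<ge> 0"
  shows "multiplier_norm_le X (B ^ k) (x ^ k)"
proof (induction k)
  case 0
  then show ?case using multiplier_norm_le_of_int[OF assms(1), of 1] by simp
next
  case (Suc k)
  then show ?case using multiplier_norm_le_mult[OF assms(2) Suc assms(3)] by simp
qed

lemma multiplier_norm_le_sum:
  assumes "finite X" "\<And>i. i \<in> I \<Longrightarrow> multiplier_norm_le X (B i) (f i)"
  shows "multiplier_norm_le X (sum B I) (sum f I)"
  using assms(2)
proof (induction I rule: infinite_finite_induct)
  case (insert i I)
  then show ?case using multiplier_norm_le_add by simp
qed (use multiplier_norm_le_of_int[OF assms(1), of 0] in auto)

text \<open>The elements of \<open>X\<close>, listed as a vector, form an eigenvector for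
  \<open>y\<close> of any integer matrix that represents \<open>y\<close>.\<close>

lemma multiplier_is_eigenvalue:
  assumes X: "finite X" "\<exists>b\<in>X. b \<noteq> 0" and y: "multiplier_norm_le X B y"
  obtains N :: "int mat" where "N \<in> carrier_mat (card X) (card X)"
    "eigenvalue (map_mat of_int N) y"
    "\<And>i. i < card X \<Longrightarrow> (\<Sum>j<card X. \<bar>real_of_int (N $$ (i, j))\<bar>) \<le> B"
proof -
  define n where "n = card X"
  obtain f where f: "bij_betw f {..<n} X"
    using ex_bij_betw_nat_finite[OF X(1)] by (auto simp: n_def atLeast0LessThan)
  obtain M where M: "\<And>b. b \<in> X \<Longrightarrow> y * b = (\<Sum>b'\<in>X. of_int (M b b') * b')"
    "\<And>b. b \<in> X \<Longrightarrow> (\<Sum>b'\<in>X. \<bar>real_of_int (M b b')\<bar>) \<le> B"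
    using y unfolding multiplier_norm_le_def by blast
  define N where "N = Matrix.mat n n (\<lambda>(i, j). M (f i) (f j))"
  define v where "v = Matrix.vec n f"
  have fX: "f i \<in> X" if "i < n" for i using f that by (auto simp: bij_betw_def)
  have sum_f: "(\<Sum>j<n. g (f j)) = sum g X" for g :: "complex \<Rightarrow> 'a :: comm_monoid_add"
    using sum.reindex_bij_betw[OF f] .
  have v0: "v \<noteq> 0\<^sub>v n"
  proof
    assume "v = 0\<^sub>v n"
    moreover obtain b i where "b \<in> X" "b \<noteq> 0" "i < n" "f i = b"
      using X(2) f by (metis bij_betw_iff_bijections lessThan_iff)
    ultimately show False by (metis v_def index_vec index_zero_vec(1))
  qed
  have "map_mat of_int N *\<^sub>v v = y \<cdot>\<^sub>v v"
  proof (rule eq_vecI)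
    fix i assume "i < dim_vec (y \<cdot>\<^sub>v v)"
    then have i: "i < n" by (simp add: v_def)
    have "(map_mat of_int N *\<^sub>v v) $ i = (\<Sum>j<n. of_int (M (f i) (f j)) * f j)"
      using i by (auto simp: N_def v_def scalar_prod_def lessThan_atLeast0 intro!: sum.cong)
    also have "\<dots> = y * f i" using sum_f[of "\<lambda>b. of_int (M (f i) b) * b"] M(1)[OF fX[OF i]] by simp
    finally show "(map_mat of_int N *\<^sub>v v) $ i = (y \<cdot>\<^sub>v v) $ i" using i by (simp add: v_def)
  qed (auto simp: N_def v_def)
  then have "eigenvector (map_mat of_int N) v y"
    using v0 unfolding eigenvector_def by (simp add: N_def v_def)
  moreover have "(\<Sum>j<n. \<bar>real_of_int (N $$ (i, j))\<bar>) \<le> B" if "i < n" for i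
    using M(2)[OF fX[OF that]] sum_f[of "\<lambda>b. \<bar>real_of_int (M (f i) b)\<bar>"] that
    by (simp add: N_def)
  ultimately show ?thesis
    using that[of N] unfolding eigenvalue_def n_def[symmetric] by (auto simp: N_def)
qed

text \<open>Compare the moduli in a coordinate where the eigenvector is largest.\<close>

lemma norm_eigenvalue_le_row_sum:
  fixes A :: "complex mat"
  assumes A: "A \<in> carrier_mat n n" and ev: "eigenvalue A z"
    and row: "\<And>i. i < n \<Longrightarrow> (\<Sum>j<n. norm (A $$ (i, j))) \<le> B"
  shows "norm z \<le> B"
proof -
  obtain w where w: "w \<in> carrier_vec n" "w \<noteq> 0\<^sub>v n" "A *\<^sub>v w = z \<cdot>\<^sub>v w"
    using ev A unfolding eigenvalue_def eigenvector_def by auto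
  obtain k where k: "k < n" "w $ k \<noteq> 0"
    using w(1,2) by (metis carrier_vecD eq_vecI index_zero_vec)
  have "Max ((\<lambda>i. norm (w $ i)) ` {..<n}) \<in> (\<lambda>i. norm (w $ i)) ` {..<n}"
    using k(1) by (intro Max_in) auto
  then obtain i where i: "i < n" "norm (w $ i) = Max ((\<lambda>i. norm (w $ i)) ` {..<n})" by auto
  then have max: "norm (w $ j) \<le> norm (w $ i)" if "j < n" for j
    using that by simp
  have pos: "norm (w $ i) > 0" using max[OF k(1)] k(2) by (meson less_le_trans zero_less_norm_iff)
  have "norm z * norm (w $ i) = norm ((A *\<^sub>v w) $ i)"
    using w i(1) by (simp add: norm_mult)
  also have "(A *\<^sub>v w) $ i = (\<Sum>j<n. A $$ (i, j) * w $ j)"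
    using w(1) A i(1) by (auto simp: scalar_prod_def lessThan_atLeast0 intro!: sum.cong)
  also have "norm \<dots> \<le> (\<Sum>j<n. norm (A $$ (i, j)) * norm (w $ i))"
    by (rule order_trans[OF norm_sum], rule sum_mono)
       (auto simp: norm_mult intro!: mult_left_mono max)
  also have "\<dots> \<le> B * norm (w $ i)"
    using row[OF i(1)] by (simp add: sum_distrib_right[symmetric] mult_right_mono)
  finally show ?thesis using pos by simp
qed

text \<open>An eigenvalue of an integer matrix is a root of its characteristic polynomial, which is
  monic with integer coefficients.\<close>

lemma algebraic_multiplier:
  assumes "finite X" "\<exists>b\<in>X. b \<noteq> 0" "multiplier X y"
  shows "algebraic y"
proof -
  obtain B where "multiplier_norm_le X B y" using multiplier_imp_norm_le assms by metis
  then obtain N :: "int mat" where N: "N \<in> carrier_mat (card X) (card X)"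
    "eigenvalue (map_mat of_int N) y"
    using multiplier_is_eigenvalue[OF assms(1,2)] by metis
  have "poly (char_poly (map_mat of_int N)) y = 0"
    using N eigenvalue_root_char_poly[of "map_mat of_int N :: complex mat" "card X" y] by auto
  then have "poly (map_poly of_int (char_poly N)) y = 0"
    using of_int_hom.char_poly_hom[OF N(1)] by metis
  moreover have "char_poly N \<noteq> 0" using degree_monic_char_poly[OF N(1)] by auto
  ultimately show ?thesis
    by (intro algebraicI[of "map_poly of_int (char_poly N)"]) auto
qed

text \<open>Liouville's inequality. The lowest nonzero coefficient of the characteristic polynomial
  of the integer matrix is, up to sign, the product of all nonzero eigenvalues. It is a nonzero
  integer, so this product has modulus at least \<open>1\<close>. One of its factors is
  \<open>y\<close>, and the others, at most \<open>card X - 1\<close> in number, have modulus at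
  most \<open>B\<close>. The eigenvalues thus take the place of the conjugates of \<open>y\<close>,
  and no number field has to be constructed.\<close>

theorem norm_multiplier_ge:
  assumes X: "finite X" "\<exists>b\<in>X. b \<noteq> 0" and y: "multiplier_norm_le X B y" "y \<noteq> 0" and B: "B \<ge> 1"
  shows "1 \<le> norm y * B ^ (card X - 1)"
proof -
  define n where "n = card X"
  obtain N :: "int mat" where N: "N \<in> carrier_mat n n" "eigenvalue (map_mat of_int N) y"
    "\<And>i. i < n \<Longrightarrow> (\<Sum>j<n. \<bar>real_of_int (N $$ (i, j))\<bar>) \<le> B"
    using multiplier_is_eigenvalue[OF X y(1)] unfolding n_def by metis
  define A :: "complex mat" where "A = map_mat of_int N"
  have A: "A \<in> carrier_mat n n" using N(1) by (simp add: A_def)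
  obtain as where as: "char_poly A = (\<Prod>a\<leftarrow>as. [:- a, 1:])" "length as = n"
    using char_poly_factorized[OF A] by blast
  have bound: "norm a \<le> B" if "a \<in> set as" for a
  proof (rule norm_eigenvalue_le_row_sum[OF A])
    show "eigenvalue A a"
      unfolding eigenvalue_root_char_poly[OF A] as(1) poly_prod_list using that
      by (auto simp: prod_list_zero_iff)
    show "(\<Sum>j<n. norm (A $$ (i, j))) \<le> B" if "i < n" for i
      using N(1) N(3)[OF that] that by (simp add: A_def)
  qed
  have y_as: "y \<in> set as"
    using N(2) unfolding A_def[symmetric] eigenvalue_root_char_poly[OF A] as(1) poly_prod_list
    by (auto simp: prod_list_zero_iff)
  define bs where "bs = filter (\<lambda>a. a \<noteq> 0) as"
  have split: "(\<Prod>a\<leftarrow>as. [:- a, 1:]) =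
      monom 1 (length (filter (\<lambda>a. a = 0) as)) * (\<Prod>b\<leftarrow>filter (\<lambda>a. a \<noteq> 0) as. [:- b, 1:])"
    for as :: "complex list"
    by (induction as) (auto simp: monom_Suc algebra_simps)
  \<comment> \<open>the multiplicity of \<open>0\<close>, hence the index of the lowest nonzero coefficient\<close>
  define k where "k = length (filter (\<lambda>a. a = 0) as)"
  have "coeff (char_poly A) k = coeff (\<Prod>b\<leftarrow>bs. [:- b, 1:]) 0"
    unfolding as(1) split[of as] bs_def[symmetric] k_def[symmetric] by (simp add: coeff_monom_mult)
  also have "\<dots> = (\<Prod>b\<leftarrow>bs. - b)"
    unfolding poly_0_coeff_0[symmetric] poly_prod_list by (simp add: o_def)
  finally have ck: "coeff (char_poly A) k = (\<Prod>b\<leftarrow>bs. - b)" .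
  have "coeff (char_poly A) k = of_int (coeff (char_poly N) k)"
    unfolding A_def of_int_hom.char_poly_hom[OF N(1)] by simp
  moreover have "(\<Prod>b\<leftarrow>bs. - b) \<noteq> 0" by (auto simp: prod_list_zero_iff bs_def)
  ultimately have "coeff (char_poly N) k \<noteq> 0" using ck by auto
  then have "1 \<le> norm (of_int (coeff (char_poly N) k) :: complex)" by simp
  also have "\<dots> = norm (\<Prod>b\<leftarrow>bs. - b)" using ck \<open>coeff (char_poly A) k = of_int _\<close> by simp
  also have "\<dots> = (\<Prod>b\<leftarrow>bs. norm b)"
    by (induction bs) (auto simp: norm_mult)
  also have "\<dots> = norm y * (\<Prod>b\<leftarrow>remove1 y bs. norm b)"
    using y_as y(2) prod_list_map_remove1[of y bs norm] by (simp add: bs_def)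
  also have "(\<Prod>b\<leftarrow>remove1 y bs. norm b) \<le> B ^ length (remove1 y bs)"
  proof -
    have "(\<Prod>b\<leftarrow>cs. norm b) \<le> B ^ length cs" if "set cs \<subseteq> set as" for cs
      using that
    proof (induction cs)
      case (Cons c cs)
      then show ?case using bound[of c] B by (auto intro!: mult_mono prod_list_nonneg)
    qed simp
    moreover have "set (remove1 y bs) \<subseteq> set as"
      using set_remove1_subset[of y bs] by (auto simp: bs_def)
    ultimately show ?thesis .
  qed
  also have "\<dots> \<le> B ^ (n - 1)"
  proof (rule power_increasing[OF _ B])
    have "length bs \<le> n" using as(2) unfolding bs_def by (metis length_filter_le)
    moreover have "y \<in> set bs" using y_as y(2) by (simp add: bs_def)
    ultimately show "length (remove1 y bs) \<le> n - 1" by (simp add: length_remove1)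
  qed
  finally show ?thesis unfolding n_def by (simp add: mult_left_mono)
qed

section \<open>Algebraic numbers as multipliers\<close>

text \<open>Multiplication by the leading coefficient of an integer polynomial that annihilates
  \<open>y\<close> turns \<open>y\<close> into a root of a monic one.\<close>

lemma algebraic_imp_integral_multiple:
  assumes "algebraic (y :: complex)"
  obtains d :: int and m :: nat and c :: "nat \<Rightarrow> int"
  where "d \<noteq> 0" "m > 0" "(of_int d * y) ^ m = (\<Sum>i<m. of_int (c i) * (of_int d * y) ^ i)"
proof -
  obtain p where p: "p \<noteq> 0" "poly (map_poly of_int p) y = 0"
    using assms by (rule algebraicE')
  define l where "l = lead_coeff p"
  define m where "m = degree p"
  have l: "l \<noteq> 0" using p(1) by (simp add: l_def)
  have sum0: "(\<Sum>i\<le>m. of_int (coeff p i) * y ^ i) = 0"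
    using p(2) by (simp add: poly_altdef m_def)
  have m: "m > 0"
  proof (rule ccontr)
    assume "\<not> m > 0"
    then show False using sum0 l by (simp add: l_def m_def)
  qed
  have "of_int l * y ^ m = - (\<Sum>i<m. of_int (coeff p i) * y ^ i)"
    using sum0 by (simp add: lessThan_Suc_atMost[symmetric] l_def m_def add_eq_0_iff)
  then have "of_int l ^ (m - 1) * (of_int l * y ^ m)
      = (\<Sum>i<m. of_int l ^ (m - 1) * (- of_int (coeff p i) * y ^ i))"
    by (simp add: sum_distrib_left sum_negf)
  also have "of_int l ^ (m - 1) * (of_int l * y ^ m) = (of_int l * y) ^ m"
    using m by (simp add: power_mult_distrib power_eq_if[of _ m])
  also have "(\<Sum>i<m. of_int l ^ (m - 1) * (- of_int (coeff p i) * y ^ i))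
      = (\<Sum>i<m. of_int (- coeff p i * l ^ (m - 1 - i)) * (of_int l * y) ^ i)"
  proof (intro sum.cong refl)
    fix i assume "i \<in> {..<m}"
    then have "m - 1 = (m - 1 - i) + i" by auto
    then have "of_int l ^ (m - 1) = (of_int l :: complex) ^ (m - 1 - i) * of_int l ^ i"
      by (metis power_add)
    then show "of_int l ^ (m - 1) * (- of_int (coeff p i) * y ^ i)
        = of_int (- coeff p i * l ^ (m - 1 - i)) * (of_int l * y) ^ i"
      by (simp add: power_mult_distrib)
  qed
  finally show ?thesis by (rule that[OF l m])
qed

text \<open>The analogue of passing from a field to a finite extension: the products of
  \<open>X\<close> with the powers of \<open>y\<close> below its degree span a module that is stable
  under \<open>y\<close> and remains stable under everything that preserved the span of
  \<open>X\<close>.\<close>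

lemma multiplier_adjoin:
  assumes X: "finite X" and m: "m > 0" and y: "y ^ m = (\<Sum>i<m. of_int (c i) * y ^ i)"
  defines "Y \<equiv> (\<lambda>(b, i). b * y ^ i) ` (X \<times> {..<m})"
  shows "finite Y" "X \<subseteq> Y" "multiplier Y y" "\<And>x. multiplier X x \<Longrightarrow> multiplier Y x"
proof -
  show fin: "finite Y" using X by (simp add: Y_def)
  show "X \<subseteq> Y"
  proof
    fix b assume "b \<in> X"
    then show "b \<in> Y" unfolding Y_def using m by (intro image_eqI[of _ _ "(b, 0)"]) auto
  qed
  have base: "b * y ^ i \<in> zspan Y" if "b \<in> X" "i < m" for b i
    using that by (intro zspan_base fin) (auto simp: Y_def)
  have top: "b * y ^ m \<in> zspan Y" if "b \<in> X" for b
  proof -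
    have "b * y ^ m = (\<Sum>i<m. of_int (c i) * (b * y ^ i))"
      by (simp add: y sum_distrib_left mult.left_commute)
    then show ?thesis using that base by (auto intro!: zspan_sum zspan_of_int_mult)
  qed
  show "multiplier Y y"
  proof (unfold multiplier_def, rule ballI)
    fix u assume "u \<in> Y"
    then obtain b i where bi: "b \<in> X" "i < m" "u = b * y ^ i" by (auto simp: Y_def)
    have "Suc i < m \<or> Suc i = m" using bi(2) by auto
    then have "b * y ^ Suc i \<in> zspan Y" using bi base top by metis
    then show "y * u \<in> zspan Y" by (simp add: bi(3) mult_ac)
  qed
  show "multiplier Y x" if x: "multiplier X x" for x
  proof (unfold multiplier_def, rule ballI)
    fix u assume "u \<in> Y"
    then obtain b i where bi: "b \<in> X" "i < m" "u = b * y ^ i" by (auto simp: Y_def)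
    have "x * b \<in> zspan X" using x bi(1) by (simp add: multiplier_def)
    then have "y ^ i * (x * b) \<in> zspan Y"
      by (rule zspan_mult_left[rotated]) (use base bi(2) in \<open>simp add: mult.commute\<close>)
    then show "x * u \<in> zspan Y" by (simp add: bi(3) mult_ac)
  qed
qed

lemma multiplier_of_int_mult: "multiplier X y \<Longrightarrow> multiplier X (of_int k * y)"
  by (auto simp: multiplier_def mult.assoc intro: zspan_of_int_mult)

lemma multiplier_add: "multiplier X x \<Longrightarrow> multiplier X y \<Longrightarrow> multiplier X (x + y)"
  by (auto simp: multiplier_def distrib_right intro: zspan_add)

lemma multiplier_mult: "multiplier X x \<Longrightarrow> multiplier X y \<Longrightarrow> multiplier X (x * y)"
  by (auto simp: multiplier_def mult.assoc intro: zspan_mult_left)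

text \<open>Finitely many algebraic numbers act, after multiplication by a common integer, on one
  finitely generated module. Its generators include \<open>1\<close>, so that a multiplier is itself
  an integer combination of generators.\<close>

theorem common_multiplier_module:
  assumes "finite S" "\<And>y. y \<in> S \<Longrightarrow> algebraic (y :: complex)"
  obtains X and d :: int where "finite X" "1 \<in> X" "d \<noteq> 0" "\<And>y. y \<in> S \<Longrightarrow> multiplier X (of_int d * y)"
proof -
  have "\<exists>X (d :: int). finite X \<and> 1 \<in> X \<and> d \<noteq> 0 \<and> (\<forall>y\<in>S. multiplier X (of_int d * y))"
    using assms
  proof (induction S rule: finite_induct)
    case empty
    show ?case by (intro exI[of _ "{1}"] exI[of _ 1]) auto
  next
    case (insert y S)
    then obtain X and d :: int where X: "finite X" "1 \<in> X" "d \<noteq> 0"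
      and S: "\<And>y. y \<in> S \<Longrightarrow> multiplier X (of_int d * y)" by auto
    obtain e :: int and m c where e: "e \<noteq> 0" "m > 0"
      "(of_int e * y) ^ m = (\<Sum>i<m. of_int (c i) * (of_int e * y) ^ i)"
      using algebraic_imp_integral_multiple[of y] insert.prems by blast
    note adj = multiplier_adjoin[OF X(1) e(2,3)]
    define Y where "Y = (\<lambda>(b, i). b * (of_int e * y) ^ i) ` (X \<times> {..<m})"
    note adj = adj[folded Y_def]
    have "multiplier Y (of_int (d * e) * x)" if "x \<in> insert y S" for x
    proof (cases "x = y")
      case True
      then show ?thesis using multiplier_of_int_mult[OF adj(3), of d] by (simp add: mult.assoc)
    next
      case False
      then show ?thesis using multiplier_of_int_mult[OF adj(4)[OF S], of x e] that
        by (simp add: mult_ac)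
    qed
    then show ?case using adj(1,2) X(2,3) e(1) by (intro exI[of _ Y] exI[of _ "d * e"]) auto
  qed
  then show ?thesis using that by blast
qed

lemma algebraic_of_int_mult_cancel:
  assumes "algebraic (of_int d * y :: complex)" "d \<noteq> 0"
  shows "algebraic y"
proof -
  obtain p where p: "p \<noteq> 0" "poly (map_poly of_int p) (of_int d * y) = 0"
    using assms(1) by (rule algebraicE')
  define q where "q = pcompose (map_poly of_int p) [:0, of_int d :: complex:]"
  have "map_poly (of_int :: int \<Rightarrow> complex) (pcompose p [:0, d:]) = q"
    by (simp add: q_def of_int_hom.map_poly_pcompose of_int_hom.map_poly_pCons_hom)
  then have "coeff q i \<in> \<int>" for i by (metis of_int_hom.coeff_map_poly_hom Ints_of_int)
  moreover have "q \<noteq> 0" unfolding q_def using p(1) assms(2) by (simp add: pcompose_eq_0_iff)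
  moreover have "poly q y = 0" using p(2) by (simp add: q_def poly_pcompose mult.commute)
  ultimately show ?thesis by (rule algebraicI)
qed

text \<open>Sums and products of multipliers of one module are multipliers of it, hence
  algebraic.\<close>

lemma algebraic_add_complex:
  assumes "algebraic (x :: complex)" "algebraic y"
  shows "algebraic (x + y)"
proof -
  obtain X and d :: int where X: "finite X" "1 \<in> X" "d \<noteq> 0"
    and S: "\<And>z. z \<in> {x, y} \<Longrightarrow> multiplier X (of_int d * z)"
    using common_multiplier_module[of "{x, y}"] assms by blast
  have "multiplier X (of_int d * (x + y))"
    using multiplier_add[of X "of_int d * x" "of_int d * y"] S by (simp add: distrib_left)
  then have "algebraic (of_int d * (x + y))"
    by (rule algebraic_multiplier[OF X(1), rotated]) (use X(2) in auto)
  then show ?thesis using X(3) by (rule algebraic_of_int_mult_cancel)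
qed

lemma algebraic_mult_complex:
  assumes "algebraic (x :: complex)" "algebraic y"
  shows "algebraic (x * y)"
proof -
  obtain X and d :: int where X: "finite X" "1 \<in> X" "d \<noteq> 0"
    and S: "\<And>z. z \<in> {x, y} \<Longrightarrow> multiplier X (of_int d * z)"
    using common_multiplier_module[of "{x, y}"] assms by blast
  have "multiplier X (of_int (d * d) * (x * y))"
    using multiplier_mult[of X "of_int d * x" "of_int d * y"] S by (simp add: mult_ac)
  then have "algebraic (of_int (d * d) * (x * y))"
    by (rule algebraic_multiplier[OF X(1), rotated]) (use X(2) in auto)
  then show ?thesis by (rule algebraic_of_int_mult_cancel) (use X(3) in auto)
qed

lemma algebraic_diff_complex: "algebraic (x :: complex) \<Longrightarrow> algebraic y \<Longrightarrow> algebraic (x - y)"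
  using algebraic_add_complex[of x "- y"] by simp

lemma algebraic_divide_complex: "algebraic (x :: complex) \<Longrightarrow> algebraic y \<Longrightarrow> algebraic (x / y)"
  unfolding divide_inverse by (intro algebraic_mult_complex algebraic_inverse)

lemma algebraic_sum_complex:
  "(\<And>i. i \<in> I \<Longrightarrow> algebraic (f i :: complex)) \<Longrightarrow> algebraic (sum f I)"
  by (induction I rule: infinite_finite_induct) (auto intro: algebraic_add_complex)

text \<open>Let the generators of a module on which the entries of \<open>A\<close> act be
  multiplied by the coordinates of an eigenvector. The equation \<open>A w = z w\<close> says that
  the resulting products span a module on which an integer multiple of the eigenvalue
  \<open>z\<close> acts.\<close>

theorem algebraic_eigenvalue:
  fixes A :: "complex mat"
  assumes A: "A \<in> carrier_mat n n" and alg: "\<And>i j. i < n \<Longrightarrow> j < n \<Longrightarrow> algebraic (A $$ (i, j))"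
    and ev: "eigenvalue A z"
  shows "algebraic z"
proof -
  define S where "S = (\<lambda>(i, j). A $$ (i, j)) ` ({..<n} \<times> {..<n})"
  have "finite S" "\<And>y. y \<in> S \<Longrightarrow> algebraic y" using alg by (auto simp: S_def)
  then obtain X and d :: int where X: "finite X" "1 \<in> X" "d \<noteq> 0"
    and S: "\<And>y. y \<in> S \<Longrightarrow> multiplier X (of_int d * y)"
    using common_multiplier_module by blast
  obtain w where w: "w \<in> carrier_vec n" "w \<noteq> 0\<^sub>v n" "A *\<^sub>v w = z \<cdot>\<^sub>v w"
    using ev A unfolding eigenvalue_def eigenvector_def by auto
  obtain k where k: "k < n" "w $ k \<noteq> 0"
    using w(1,2) by (metis carrier_vecD eq_vecI index_zero_vec)
  define Y where "Y = (\<lambda>(b, i). b * w $ i) ` (X \<times> {..<n})"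
  have Y: "finite Y" using X(1) by (simp add: Y_def)
  have "multiplier Y (of_int d * z)"
  proof (unfold multiplier_def, rule ballI)
    fix u assume "u \<in> Y"
    then obtain b i where bi: "b \<in> X" "i < n" "u = b * w $ i" by (auto simp: Y_def)
    have "z * w $ i = (A *\<^sub>v w) $ i" using w bi(2) by simp
    also have "\<dots> = (\<Sum>j<n. A $$ (i, j) * w $ j)"
      using w(1) A bi(2) by (auto simp: scalar_prod_def lessThan_atLeast0 intro!: sum.cong)
    finally have zw: "z * w $ i = (\<Sum>j<n. A $$ (i, j) * w $ j)" .
    have "of_int d * z * u = of_int d * b * (z * w $ i)" by (simp add: bi(3))
    also have "\<dots> = (\<Sum>j<n. w $ j * (of_int d * A $$ (i, j) * b))"
      unfolding zw by (simp add: sum_distrib_left mult_ac)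
    finally have "of_int d * z * u = (\<Sum>j<n. w $ j * (of_int d * A $$ (i, j) * b))" .
    moreover have "w $ j * (of_int d * A $$ (i, j) * b) \<in> zspan Y" if "j < n" for j
    proof (rule zspan_mult_left)
      show "of_int d * A $$ (i, j) * b \<in> zspan X"
        using S[of "A $$ (i, j)"] bi that by (auto simp: S_def multiplier_def)
      show "w $ j * b' \<in> zspan Y" if "b' \<in> X" for b'
        using that \<open>j < n\<close> by (intro zspan_base Y) (auto simp: Y_def mult.commute)
    qed
    ultimately show "of_int d * z * u \<in> zspan Y" by (auto intro!: zspan_sum)
  qed
  moreover have "w $ k \<in> Y"
    unfolding Y_def using X(2) k(1) by (intro image_eqI[of _ _ "(1, k)"]) auto
  ultimately have "algebraic (of_int d * z)" using algebraic_multiplier[OF Y] k(2) by blast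
  then show ?thesis using X(3) by (rule algebraic_of_int_mult_cancel)
qed

section \<open>Siegel's lemma\<close>

text \<open>Pigeonhole principle. Let \<open>N\<close> be the number of unknowns and let each of
  them range over \<open>{0..Q}\<close>, where \<open>Q = 2 N C\<close>. Each equation then takes at
  most \<open>2 N C Q + 1 < (Q + 1)\<^sup>2\<close> values. As there are twice as many unknowns as
  equations, two different vectors have the same values, and their difference is a solution.\<close>

theorem siegel_lemma:
  fixes A :: "'e \<Rightarrow> 'u \<Rightarrow> int"
  assumes E: "finite E" and U: "finite U" "U \<noteq> {}" "card U = 2 * card E"
    and A: "\<And>e u. e \<in> E \<Longrightarrow> u \<in> U \<Longrightarrow> \<bar>A e u\<bar> \<le> int C" and C: "C \<ge> 1"
  obtains x :: "'u \<Rightarrow> int" where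
    "\<And>e. e \<in> E \<Longrightarrow> (\<Sum>u\<in>U. A e u * x u) = 0"
    "\<exists>u\<in>U. x u \<noteq> 0"
    "\<And>u. u \<in> U \<Longrightarrow> \<bar>x u\<bar> \<le> 2 * int (card U) * int C"
proof -
  define N where "N = card U"
  define Q where "Q = 2 * N * C"
  define D where "D = U \<rightarrow>\<^sub>E {0..int Q}"
  define R where "R = E \<rightarrow>\<^sub>E {- int (N * C * Q)..int (N * C * Q)}"
  define f where "f = (\<lambda>x. \<lambda>e\<in>E. \<Sum>u\<in>U. A e u * x u)"
  have N: "N > 0" using U(1,2) card_gt_0_iff[of U] unfolding N_def by blast
  have fR: "f x \<in> R" if x: "x \<in> D" for x
  proof -
    have "\<bar>\<Sum>u\<in>U. A e u * x u\<bar> \<le> int (N * C * Q)" if e: "e \<in> E" for e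
    proof -
      have "\<bar>\<Sum>u\<in>U. A e u * x u\<bar> \<le> (\<Sum>u\<in>U. \<bar>A e u\<bar> * \<bar>x u\<bar>)"
        by (rule order_trans[OF sum_abs]) (simp add: abs_mult)
      also have "\<dots> \<le> (\<Sum>u\<in>U. int C * int Q)"
        using A[OF e] x by (intro sum_mono mult_mono) (auto simp: D_def PiE_iff)
      finally show ?thesis by (simp add: N_def)
    qed
    then show ?thesis by (auto simp: R_def f_def abs_le_iff)
       (metis minus_le_iff mult.assoc of_nat_mult)+
  qed
  have cardD: "card D = (Q + 1) ^ N"
    using U by (simp add: D_def card_PiE N_def nat_add_distrib)
  have "card R = (2 * N * C * Q + 1) ^ card E"
  proof -
    have "card {- int (N * C * Q)..int (N * C * Q)} = 2 * N * C * Q + 1"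
      by (simp add: nat_eq_iff)
    then show ?thesis unfolding R_def by (simp add: card_PiE[OF E])
  qed
  also have "2 * N * C * Q + 1 < (Q + 1) ^ 2"
    using N C by (simp add: Q_def power2_eq_square algebra_simps)
  then have "(2 * N * C * Q + 1) ^ card E < ((Q + 1) ^ 2) ^ card E"
    using U(3) N by (intro power_strict_mono) (auto simp: N_def)
  also have "\<dots> = card D" unfolding cardD using U(3) by (simp add: N_def power_mult[symmetric])
  finally have "card R < card D" .
  moreover have "f ` D \<subseteq> R" using fR by auto
  moreover have "finite R" unfolding R_def using E by (intro finite_PiE) auto
  ultimately have "\<not> inj_on f D" by (metis card_inj_on_le not_le)
  then obtain x y where xy: "x \<in> D" "y \<in> D" "x \<noteq> y" "f x = f y" by (auto simp: inj_on_def)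
  show ?thesis
  proof (rule that[of "\<lambda>u. x u - y u"])
    fix e assume e: "e \<in> E"
    have "f x e = f y e" using xy(4) by simp
    then show "(\<Sum>u\<in>U. A e u * (x u - y u)) = 0"
      using e by (simp add: f_def right_diff_distrib sum_subtractf)
  next
    have "\<exists>u\<in>U. x u \<noteq> y u" using xy(1-3) unfolding D_def by (metis PiE_ext)
    then show "\<exists>u\<in>U. x u - y u \<noteq> 0" by auto
  next
    fix u assume "u \<in> U"
    then have "x u \<in> {0..int Q}" "y u \<in> {0..int Q}" using xy(1,2) by (auto simp: D_def PiE_iff)
    then have "\<bar>x u - y u\<bar> \<le> int Q" by auto
    then show "\<bar>x u - y u\<bar> \<le> 2 * int (card U) * int C" by (simp add: Q_def N_def)
  qed
qed

section \<open>Entire functions with many zeros\<close>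

lemma entire_power_series:
  assumes "\<And>z. (\<lambda>i. c i * (z - a) ^ i) sums (f z :: complex)"
  shows "f holomorphic_on UNIV"
proof -
  have "f holomorphic_on ball a R" for R
    by (rule power_series_holomorphic[where a = c]) (rule assms)
  then have "f holomorphic_on (\<Union>R\<in>UNIV. ball a R)" by (intro holomorphic_on_UN_open) auto
  also have "(\<Union>R\<in>UNIV. ball a R) = UNIV" by (auto intro: lt_ex gt_ex)
  finally show ?thesis .
qed

text \<open>Shift the power series at \<open>a\<close>. The value of the cofactor at
  \<open>a\<close> is the first coefficient that may be nonzero.\<close>

lemma entire_factor_zero:
  assumes f: "\<And>z. (\<lambda>i. c i * (z - a) ^ i) sums (f z :: complex)" and c: "\<And>i. i < r \<Longrightarrow> c i = 0"
  obtains g where "g holomorphic_on UNIV" "\<And>z. f z = (z - a) ^ r * g z" "g a = c r"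
proof -
  define g where "g z = (\<Sum>i. c (i + r) * (z - a) ^ i)" for z
  have shift: "(\<lambda>i. c (i + r) * (z - a) ^ (i + r)) sums f z" for z
    using sums_iff_shift'[of "\<lambda>i. c i * (z - a) ^ i" r "f z"] f[of z] c by simp
  have summable: "summable (\<lambda>i. c (i + r) * (z - a) ^ i)" for z
  proof (cases "z = a")
    case True
    then show ?thesis
      by (intro summable_finite[of "{0}"]) (auto simp: power_0_left)
  next
    case False
    have "summable (\<lambda>i. c (i + r) * (z - a) ^ (i + r) / (z - a) ^ r)"
      using shift[of z] by (intro summable_divide) (auto simp: sums_iff)
    then show ?thesis using False by (simp add: power_add)
  qed
  have sums: "(\<lambda>i. c (i + r) * (z - a) ^ i) sums g z" for z
    using summable[of z] unfolding g_def by (rule summable_sums)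
  show ?thesis
  proof
    show "g holomorphic_on UNIV" by (rule entire_power_series[where c = "\<lambda>i. c (i + r)"]) (rule sums)
    show "f z = (z - a) ^ r * g z" for z
    proof -
      have "(\<lambda>i. (z - a) ^ r * (c (i + r) * (z - a) ^ i)) sums ((z - a) ^ r * g z)"
        by (rule sums_mult[OF sums])
      then have "(\<lambda>i. c (i + r) * (z - a) ^ (i + r)) sums ((z - a) ^ r * g z)"
        by (simp add: power_add mult_ac)
      then show ?thesis using shift[of z] sums_unique2 by blast
    qed
    have "(\<lambda>i. c (i + r) * (a - a) ^ i) sums (c (0 + r))"
      using powser_sums_zero[of "\<lambda>i. c (i + r)"] by simp
    then show "g a = c r" using sums[of a] sums_unique2 by fastforce
  qed
qed

text \<open>Zeros at different points can be divided out simultaneously. In the induction step the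
  quotient of the cofactor \<open>H\<close> by \<open>(z - b) ^ r\<close> is holomorphic away from
  \<open>b\<close>. Away from \<open>S\<close> it agrees with a quotient of the cofactor at
  \<open>b\<close>, and the two open sets cover the plane.\<close>

lemma entire_factor_finite_zeros:
  fixes f :: "complex \<Rightarrow> complex"
  assumes "finite S" "f holomorphic_on UNIV"
    and "\<And>a. a \<in> S \<Longrightarrow> \<exists>g. g holomorphic_on UNIV \<and> (\<forall>z. f z = (z - a) ^ r * g z)"
  obtains H where "H holomorphic_on UNIV" "\<And>z. f z = (\<Prod>a\<in>S. (z - a) ^ r) * H z"
proof -
  have "\<exists>H. H holomorphic_on UNIV \<and> (\<forall>z. f z = (\<Prod>a\<in>S. (z - a) ^ r) * H z)"
    using assms
  proof (induction S rule: finite_induct)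
    case empty
    then show ?case by auto
  next
    case (insert b S)
    obtain H where H: "H holomorphic_on UNIV" "\<And>z. f z = (\<Prod>a\<in>S. (z - a) ^ r) * H z"
      using insert by auto
    obtain h where h: "h holomorphic_on UNIV" "\<And>z. f z = (z - b) ^ r * h z"
      using insert.prems by blast
    define P where "P z = (\<Prod>a\<in>S. (z - a) ^ r)" for z
    have P0: "P z \<noteq> 0" if "z \<notin> S" for z
      using that insert.hyps by (auto simp: P_def)
    define K where "K z = (if z = b then h b / P b else H z / (z - b) ^ r)" for z
    have K1: "K z = h z / P z" if "z \<notin> S" for z
    proof (cases "z = b")
      case False
      then show ?thesis using H(2)[of z] h(2)[of z] P0[OF that] unfolding K_def P_def[symmetric]
        by (simp add: field_simps)
    qed (simp add: K_def)
    have "(\<lambda>z. h z / P z) holomorphic_on - S"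
      unfolding P_def using P0 insert.hyps(1) unfolding P_def
      by (intro holomorphic_intros holomorphic_on_subset[OF h(1)]) auto
    then have "K holomorphic_on - S"
      by (rule holomorphic_transform) (use K1 in auto)
    moreover have "(\<lambda>z. H z / (z - b) ^ r) holomorphic_on - {b}"
      by (intro holomorphic_intros holomorphic_on_subset[OF H(1)]) auto
    then have "K holomorphic_on - {b}"
      by (rule holomorphic_transform) (auto simp: K_def)
    ultimately have "K holomorphic_on - S \<union> - {b}"
      by (rule holomorphic_on_Un) (use insert.hyps(1) in \<open>auto intro: finite_imp_closed\<close>)
    also have "- S \<union> - {b} = UNIV" using insert.hyps(2) by auto
    finally have "K holomorphic_on UNIV" .
    moreover have "f z = (\<Prod>a\<in>insert b S. (z - a) ^ r) * K z" for z
    proof (cases "z = b")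
      case True
      have "f b = (b - b) ^ r * h b" by (rule h(2))
      then show ?thesis using True insert.hyps P0[OF insert.hyps(2)] by (simp add: K_def P_def)
    next
      case False
      then show ?thesis using H(2)[of z] insert.hyps by (simp add: K_def)
    qed
    ultimately show ?case by blast
  qed
  then show ?thesis using that by blast
qed

text \<open>The idea of the Schwarz lemma: divide \<open>f\<close> by \<open>\<Prod>b\<in>S. (z - b)
  ^ r\<close>. On the circle of radius \<open>R\<close> the divisor has modulus at least \<open>(R /
  2) ^ (r * card S)\<close>, so the maximum modulus principle bounds the quotient at
  \<open>a\<close>. The coefficient is this quotient times the product over the other
  points.\<close>

theorem schwarz_lemma_many_zeros:
  fixes f :: "complex \<Rightarrow> complex"
  assumes S: "finite S" "a \<in> S" and f: "\<And>a z. a \<in> S \<Longrightarrow> (\<lambda>i. c a i * (z - a) ^ i) sums f z"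
    and c: "\<And>a i. a \<in> S \<Longrightarrow> i < r \<Longrightarrow> c a i = 0"
    and R: "R > 0" "\<And>a. a \<in> S \<Longrightarrow> norm a \<le> R / 2"
    and M: "\<And>z. norm z = R \<Longrightarrow> norm (f z) \<le> M"
    and L: "\<And>b. b \<in> S \<Longrightarrow> norm (a - b) \<le> L" "L \<ge> 1"
  shows "norm (c a r) \<le> M * (L * 2 / R) ^ (r * card S)"
proof -
  have hol: "f holomorphic_on UNIV" using entire_power_series f S(2) by blast
  have "\<exists>g. g holomorphic_on UNIV \<and> (\<forall>z. f z = (z - b) ^ r * g z)" if b: "b \<in> S" for b
    using entire_factor_zero[OF f[OF b] c[OF b], of r] by metis
  then obtain H where H: "H holomorphic_on UNIV" "\<And>z. f z = (\<Prod>b\<in>S. (z - b) ^ r) * H z"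
    using entire_factor_finite_zeros[OF S(1) hol] by blast
  obtain g where g: "g holomorphic_on UNIV" "\<And>z. f z = (z - a) ^ r * g z" "g a = c a r"
    using entire_factor_zero[OF f[OF S(2)] c[OF S(2)], of r] by metis
  define P where "P z = (\<Prod>b\<in>S - {a}. (z - b) ^ r)" for z
  have "g z = P z * H z" if "z \<noteq> a" for z
  proof -
    have "(z - a) ^ r * g z = (z - a) ^ r * (P z * H z)"
      using g(2)[of z] H(2)[of z] unfolding prod.remove[OF S] P_def by (simp only: mult.assoc)
    then show ?thesis using that by simp
  qed
  moreover have "continuous_on UNIV g" "continuous_on UNIV (\<lambda>z. P z * H z)"
    using g(1) H(1) unfolding P_def
    by (auto intro!: holomorphic_on_imp_continuous_on holomorphic_intros)
  ultimately have "g a = P a * H a"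
  proof -
    have "isCont g a" "isCont (\<lambda>z. P z * H z) a"
      using \<open>continuous_on UNIV g\<close> \<open>continuous_on UNIV (\<lambda>z. P z * H z)\<close>
      by (auto simp: continuous_on_eq_continuous_at)
    then have lim: "g \<midarrow>a\<rightarrow> g a" "(\<lambda>z. P z * H z) \<midarrow>a\<rightarrow> P a * H a" by (auto simp: isCont_def)
    have "(\<lambda>z. P z * H z) \<midarrow>a\<rightarrow> g a"
      using lim(1) by (rule Lim_transform_eventually)
        (auto simp: eventually_at_filter \<open>\<And>z. z \<noteq> a \<Longrightarrow> g z = P z * H z\<close>)
    then show ?thesis using lim(2) LIM_unique by blast
  qed
  then have car: "c a r = P a * H a" using g(3) by simp
  have M0: "M \<ge> 0"
    using R(1) by (intro order_trans[OF norm_ge_zero M[of "of_real R"]]) simp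
  have Hb: "norm (H a) \<le> M * (2 / R) ^ (r * card S)"
  proof (rule maximum_modulus_frontier[where S = "cball 0 R" and f = H and \<xi> = a])
    show "H holomorphic_on interior (cball 0 R)" "continuous_on (closure (cball 0 R)) H"
      using H(1) by (auto intro: holomorphic_on_subset holomorphic_on_imp_continuous_on continuous_on_subset)
    show "bounded (cball 0 R :: complex set)" by simp
    show "a \<in> cball 0 R" using R(2)[OF S(2)] R(1) by auto
    fix z :: complex assume "z \<in> frontier (cball 0 R)"
    then have z: "norm z = R" using R(1) by auto
    have "(R / 2) ^ (r * card S) = (\<Prod>b\<in>S. (R / 2) ^ r)" by (simp add: power_mult)
    also have "\<dots> \<le> (\<Prod>b\<in>S. norm (z - b) ^ r)"
    proof (intro prod_mono conjI power_mono)
      fix b assume "b \<in> S"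
      then show "R / 2 \<le> norm (z - b)" using R(2)[of b] z norm_triangle_ineq2[of z b] by simp
    qed (use R(1) in auto)
    also have "\<dots> = norm (\<Prod>b\<in>S. (z - b) ^ r)" by (simp add: prod_norm[symmetric] norm_power)
    finally have "(R / 2) ^ (r * card S) * norm (H z) \<le> M"
      using H(2)[of z] M[OF z] by (smt (verit) mult_right_mono norm_ge_zero norm_mult)
    then show "norm (H z) \<le> M * (2 / R) ^ (r * card S)"
      using R(1) by (simp add: power_divide field_simps)
  qed
  have "norm (P a) = (\<Prod>b\<in>S - {a}. norm (a - b) ^ r)"
    by (simp add: P_def prod_norm[symmetric] norm_power)
  also have "\<dots> \<le> (\<Prod>b\<in>S - {a}. L ^ r)" using L by (intro prod_mono) (auto intro: power_mono)
  also have "\<dots> \<le> L ^ (r * card S)"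
    using L(2) S by (auto simp: power_mult[symmetric] card_Diff_singleton intro!: power_increasing)
  finally have "norm (P a) \<le> L ^ (r * card S)" .
  then have "norm (c a r) \<le> L ^ (r * card S) * (M * (2 / R) ^ (r * card S))"
    unfolding car norm_mult using Hb L(2) by (intro mult_mono) auto
  also have "\<dots> = M * (L * 2 / R) ^ (r * card S)"
    by (simp add: power_mult_distrib power_divide)
  finally show ?thesis .
qed

lemma exponential_sum_expansion:
  fixes x w :: "'u \<Rightarrow> complex"
  shows "(\<lambda>i. (\<Sum>u\<in>U. x u * w u ^ i * exp (w u * a)) / fact i * (z - a) ^ i)
    sums (\<Sum>u\<in>U. x u * exp (w u * z))"
proof -
  have "(\<lambda>i. x u * w u ^ i * exp (w u * a) / fact i * (z - a) ^ i) sums (x u * exp (w u * z))" for u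
  proof -
    have "(\<lambda>i. (w u * (z - a)) ^ i /\<^sub>R fact i) sums exp (w u * (z - a))" by (rule exp_converges)
    then have "(\<lambda>i. x u * exp (w u * a) * ((w u * (z - a)) ^ i /\<^sub>R fact i))
        sums (x u * exp (w u * a) * exp (w u * (z - a)))" by (rule sums_mult)
    also have "x u * exp (w u * a) * exp (w u * (z - a)) = x u * exp (w u * z)"
      by (simp add: mult.assoc exp_add[symmetric] right_diff_distrib)
    also have "(\<lambda>i. x u * exp (w u * a) * ((w u * (z - a)) ^ i /\<^sub>R fact i))
        = (\<lambda>i. x u * w u ^ i * exp (w u * a) / fact i * (z - a) ^ i)"
      by (simp add: scaleR_conv_of_real power_mult_distrib divide_inverse mult_ac)
    finally show ?thesis .
  qed
  then have "(\<lambda>i. \<Sum>u\<in>U. x u * w u ^ i * exp (w u * a) / fact i * (z - a) ^ i)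
      sums (\<Sum>u\<in>U. x u * exp (w u * z))" by (intro sums_sum)
  then show ?thesis by (simp add: sum_divide_distrib sum_distrib_right)
qed

text \<open>The sum on the left is the \<open>r\<close>-th derivative at \<open>a\<close> of the
  exponential sum \<open>\<Sum>u\<in>U. x u * exp (w u * z)\<close>, and the hypothesis
  \<open>zero\<close> says that the derivatives of smaller order vanish at all points of
  \<open>S\<close>.\<close>

theorem exponential_sum_derivative_bound:
  fixes x w :: "'u \<Rightarrow> complex"
  assumes S: "finite S" "a \<in> S"
    and zero: "\<And>i b. i < r \<Longrightarrow> b \<in> S \<Longrightarrow> (\<Sum>u\<in>U. x u * w u ^ i * exp (w u * b)) = 0"
    and R: "R > 0" "\<And>a. a \<in> S \<Longrightarrow> norm a \<le> R / 2"
    and L: "\<And>b. b \<in> S \<Longrightarrow> norm (a - b) \<le> L" "L \<ge> 1"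
    and x: "\<And>u. u \<in> U \<Longrightarrow> norm (x u) \<le> A" and w: "\<And>u. u \<in> U \<Longrightarrow> norm (w u) \<le> W"
  shows "norm (\<Sum>u\<in>U. x u * w u ^ r * exp (w u * a))
    \<le> fact r * (real (card U) * A * exp (W * R)) * (L * 2 / R) ^ (r * card S)"
proof -
  define c where "c a i = (\<Sum>u\<in>U. x u * w u ^ i * exp (w u * a)) / fact i" for a i
  have "norm (c a r) \<le> (real (card U) * A * exp (W * R)) * (L * 2 / R) ^ (r * card S)"
  proof (rule schwarz_lemma_many_zeros[OF S _ _ R _ L])
    show "(\<lambda>i. c b i * (z - b) ^ i) sums (\<Sum>u\<in>U. x u * exp (w u * z))" for b z
      unfolding c_def by (rule exponential_sum_expansion)
    show "c b i = 0" if "b \<in> S" "i < r" for b i using zero that by (simp add: c_def)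
    fix z :: complex assume z: "norm z = R"
    have "norm (\<Sum>u\<in>U. x u * exp (w u * z)) \<le> (\<Sum>u\<in>U. A * exp (W * R))"
    proof (rule order_trans[OF norm_sum], rule sum_mono)
      fix u assume u: "u \<in> U"
      have "norm (exp (w u * z)) \<le> exp (norm (w u * z))" by (rule norm_exp)
      also have "\<dots> \<le> exp (W * R)" using w[OF u] z R(1) by (simp add: norm_mult mult_right_mono)
      finally show "norm (x u * exp (w u * z)) \<le> A * exp (W * R)"
        unfolding norm_mult using x[OF u] by (intro mult_mono) (auto intro: order_trans[OF norm_ge_zero])
    qed
    then show "norm (\<Sum>u\<in>U. x u * exp (w u * z)) \<le> real (card U) * A * exp (W * R)" by simp
  qed auto
  then show ?thesis
    unfolding c_def by (simp add: norm_divide field_simps)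
qed

text \<open>Nonsingularity of the Vandermonde matrix: the hypothesis extends from powers to all
  polynomials in the nodes, in particular to one that vanishes at every node except \<open>w
  v\<close>.\<close>

lemma power_sums_zero_imp_zero:
  fixes x w :: "'u \<Rightarrow> complex"
  assumes U: "finite U" "inj_on w U" and zero: "\<And>i. (\<Sum>u\<in>U. x u * w u ^ i) = 0" and v: "v \<in> U"
  shows "x v = 0"
proof -
  have poly: "(\<Sum>u\<in>U. x u * poly p (w u)) = 0" for p
  proof -
    have "(\<Sum>u\<in>U. x u * poly p (w u)) = (\<Sum>u\<in>U. \<Sum>i\<le>degree p. coeff p i * (x u * w u ^ i))"
      by (simp add: poly_altdef sum_distrib_left mult_ac)
    also have "\<dots> = (\<Sum>i\<le>degree p. coeff p i * (\<Sum>u\<in>U. x u * w u ^ i))"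
      by (subst sum.swap) (simp add: sum_distrib_left)
    finally show ?thesis by (simp add: zero)
  qed
  define p where "p = (\<Prod>u\<in>U - {v}. [:- w u, 1:])"
  have "(\<Sum>u\<in>U. x u * poly p (w u)) = x v * poly p (w v)"
  proof (rule sum.remove[OF U(1) v, THEN trans])
    have "poly p (w u) = 0" if "u \<in> U - {v}" for u
      using that U(1) by (auto simp: p_def poly_prod)
    then show "x v * poly p (w v) + (\<Sum>u\<in>U - {v}. x u * poly p (w u)) = x v * poly p (w v)" by simp
  qed
  moreover have "poly p (w v) \<noteq> 0"
    using U v by (auto simp: p_def poly_prod inj_on_def)
  ultimately show ?thesis using poly[of p] by simp
qed

section \<open>The Gelfond-Schneider theorem\<close>

text \<open>In the application \<open>\<delta>\<close> is a common denominator and \<open>a\<close>,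
  \<open>b\<close>, \<open>g\<close> are the multiples by \<open>\<delta>\<close> of \<open>exp
  \<omega>\<close>, \<open>\<beta>\<close> and \<open>exp (\<omega> * \<beta>)\<close>. The power of
  \<open>\<delta>\<close> fills the monomial up to a degree that depends only on
  \<open>s\<close>.\<close>

lemma multiplier_norm_le_monomial:
  fixes D :: real
  assumes X: "finite X" and D: "D \<ge> 1"
    and mult: "multiplier_norm_le X D \<delta>" "multiplier_norm_le X D a" "multiplier_norm_le X D b" "multiplier_norm_le X D g"
    and j: "j \<le> q" and l: "l \<le> q" and \<mu>: "\<mu> \<le> m"
  shows "multiplier_norm_le X ((2 * real q * D) ^ s * D ^ (2 * q * m))
    ((of_nat j * \<delta> + of_nat l * b) ^ s * a ^ (j * \<mu>) * g ^ (l * \<mu>) * \<delta> ^ (2 * q * m - j * \<mu> - l * \<mu>))"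
proof -
  have nat: "multiplier_norm_le X (real n) (of_nat n)" for n
    using multiplier_norm_le_of_int[OF X, of "int n"] by simp
  have D0: "D \<ge> 0" using D by simp
  have "multiplier_norm_le X (real j * D + real l * D) (of_nat j * \<delta> + of_nat l * b)"
    by (intro multiplier_norm_le_add multiplier_norm_le_mult nat mult) auto
  moreover have "real j * D + real l * D \<le> real q * D + real q * D"
    using j l D by (intro add_mono mult_right_mono) auto
  ultimately have lin: "multiplier_norm_le X (2 * real q * D) (of_nat j * \<delta> + of_nat l * b)"
    by (elim multiplier_norm_le_mono) (simp add: mult_ac)
  have "multiplier_norm_le X
      ((2 * real q * D) ^ s * D ^ (j * \<mu>) * D ^ (l * \<mu>) * D ^ (2 * q * m - j * \<mu> - l * \<mu>))
      ((of_nat j * \<delta> + of_nat l * b) ^ s * a ^ (j * \<mu>) * g ^ (l * \<mu>) * \<delta> ^ (2 * q * m - j * \<mu> - l * \<mu>))"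
    using D0 by (intro multiplier_norm_le_mult multiplier_norm_le_power X lin mult)
      (auto intro!: mult_nonneg_nonneg)
  moreover have "j * \<mu> + l * \<mu> \<le> 2 * q * m"
    using mult_le_mono[OF j \<mu>] mult_le_mono[OF l \<mu>] by simp
  then have "D ^ (j * \<mu>) * D ^ (l * \<mu>) * D ^ (2 * q * m - j * \<mu> - l * \<mu>) = D ^ (2 * q * m)"
    by (simp add: power_add[symmetric])
  ultimately show ?thesis by (simp add: mult.assoc)
qed

lemma monomial_scaling:
  fixes \<delta> \<alpha> \<beta> \<gamma> :: complex
  assumes j: "j \<le> q" and l: "l \<le> q" and \<mu>: "\<mu> \<le> m"
  shows "(of_nat j * \<delta> + of_nat l * (\<delta> * \<beta>)) ^ s * (\<delta> * \<alpha>) ^ (j * \<mu>) * (\<delta> * \<gamma>) ^ (l * \<mu>)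
      * \<delta> ^ (2 * q * m - j * \<mu> - l * \<mu>)
    = \<delta> ^ (s + 2 * q * m) * ((of_nat j + of_nat l * \<beta>) ^ s * \<alpha> ^ (j * \<mu>) * \<gamma> ^ (l * \<mu>))"
proof -
  have "j * \<mu> + l * \<mu> \<le> 2 * q * m"
    using mult_le_mono[OF j \<mu>] mult_le_mono[OF l \<mu>] by simp
  then have e: "\<delta> ^ (s + 2 * q * m) = \<delta> ^ s * \<delta> ^ (j * \<mu>) * \<delta> ^ (l * \<mu>) * \<delta> ^ (2 * q * m - j * \<mu> - l * \<mu>)"
    by (simp add: power_add[symmetric])
  have "of_nat j * \<delta> + of_nat l * (\<delta> * \<beta>) = \<delta> * (of_nat j + of_nat l * \<beta>)"
    by (simp add: algebra_simps)
  then show ?thesis unfolding e by (simp only: power_mult_distrib mult_ac)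
qed

text \<open>The core of Gelfond's method, applied to the exponential sum \<open>F z = (\<Sum>(j,l).
  x (j,l) * exp (\<omega> * (j + l * \<beta>) * z))\<close> with \<open>q\<^sup>2\<close> terms and
  integer coefficients. Its derivatives at the integers \<open>\<mu> < m\<close> are, up to powers
  of \<open>\<omega>\<close>, polynomials in \<open>\<beta>\<close>, \<open>exp \<omega>\<close> and
  \<open>exp (\<omega> * \<beta>)\<close>. That those of order less than \<open>n = c
  k\<^sup>2\<close> vanish there follows from \<open>n m h\<close> integer linear equations for the
  coefficients, one for each order, point and generator of the module. The choice of
  \<open>c\<close> and \<open>q\<close> makes this half of the number \<open>q\<^sup>2\<close> of
  unknowns, so that Siegel's lemma yields small coefficients.

  As \<open>\<beta>\<close> is irrational, the frequencies \<open>\<omega> * (j + l *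
  \<beta>)\<close> are distinct, so \<open>F\<close> has some nonzero derivative at
  \<open>0\<close>. Therefore a least order \<open>r \<ge> n\<close> exists at which a derivative is
  nonzero at one of the points. The number \<open>N\<close> is the modulus of this derivative,
  scaled to be a multiplier of the module. It satisfies Liouville's inequality from below, and from
  above the Schwarz lemma on the circle of radius \<open>r / q\<close>: with this radius the
  exponentials grow only by a factor of the form \<open>exp (const * r)\<close>, and \<open>k \<ge>
  2 * m\<close> puts the points into the disc of half the radius.\<close>

lemma gelfond_inequalities:
  fixes \<omega> \<beta> :: complex and d :: int and D h m c k q :: nat
  assumes X: "finite X" "1 \<in> X" and d: "d \<noteq> 0" "\<bar>d\<bar> \<le> int D" and D: "D \<ge> 1"
    and mult: "multiplier_norm_le X D (of_int d)" "multiplier_norm_le X D (of_int d * exp \<omega>)"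
      "multiplier_norm_le X D (of_int d * \<beta>)" "multiplier_norm_le X D (of_int d * exp (\<omega> * \<beta>))"
    and \<omega>: "\<omega> \<noteq> 0" and \<beta>: "\<beta> \<notin> \<rat>"
  assumes h: "h = card X" and m: "m \<ge> 1" and c: "c = 2 * m * h" and k: "k \<ge> 2 * m" and q: "q = c * k"
  obtains r :: nat and N :: real where "r \<ge> c * k\<^sup>2"
    "1 \<le> N * (real q ^ 2 * (2 * real q ^ 2 * ((2 * q * D) ^ r * D ^ (2 * q * m))) * ((2 * q * D) ^ r * D ^ (2 * q * m))) ^ (h - 1)"
    "N \<le> D ^ (r + 2 * q * m) / norm \<omega> ^ r * (fact r * (real q ^ 2 * (2 * real q ^ 2 * ((2 * q * D) ^ r * D ^ (2 * q * m)))
       * exp (norm \<omega> * (1 + norm \<beta>) * r)) * (2 * m * q / r) ^ (r * m))"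
proof -
  define n where "n = c * k\<^sup>2"
  define \<alpha> where "\<alpha> = exp \<omega>"
  define \<gamma> where "\<gamma> = exp (\<omega> * \<beta>)"
  define \<delta> :: complex where "\<delta> = of_int d"
  define U where "U = {..<q} \<times> {..<q}"
  define v where "v s \<mu> u = (case u of (j, l) \<Rightarrow>
    (of_nat j * \<delta> + of_nat l * (\<delta> * \<beta>)) ^ s * (\<delta> * \<alpha>) ^ (j * \<mu>) * (\<delta> * \<gamma>) ^ (l * \<mu>)
      * \<delta> ^ (2 * q * m - j * \<mu> - l * \<mu>))" for s \<mu> u
  define w where "w u = (case u of (j, l) \<Rightarrow> \<omega> * (of_nat j + of_nat l * \<beta>))" for u :: "nat \<times> nat"
  define C where "C s = (2 * q * D) ^ s * D ^ (2 * q * m)" for s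
  have h0: "h > 0" using X by (auto simp: h card_gt_0_iff)
  have pos: "c > 0" "k > 0" "q > 0" "n > 0" using m k h0 by (auto simp: c q n_def)
  have C1: "C s \<ge> 1" for s using pos D by (simp add: C_def Suc_le_eq)
  have Cmono: "C s \<le> C r" if "s \<le> r" for s r
    unfolding C_def using pos D that by (intro mult_right_mono power_increasing) (auto simp: Suc_le_eq)
  have vnorm: "multiplier_norm_le X (C s) (v s \<mu> u)" if uU: "u \<in> U" and mu: "\<mu> < m" for s \<mu> u
  proof -
    obtain j l where u: "u = (j, l)" "j < q" "l < q" using uU by (cases u) (auto simp: U_def)
    show ?thesis
      using multiplier_norm_le_monomial[OF X(1) _ mult, of j q l \<mu> m s] D u mu
      by (simp add: v_def C_def \<delta>_def \<alpha>_def \<gamma>_def)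
  qed
  \<comment> \<open>the monomials are, up to nonzero factors, the derivatives of the exponentials\<close>
  have vw: "\<omega> ^ s * v s \<mu> u = \<delta> ^ (s + 2 * q * m) * (w u ^ s * exp (w u * of_nat \<mu>))"
    if uU: "u \<in> U" and mu: "\<mu> < m" for s \<mu> u
  proof -
    obtain j l where u: "u = (j, l)" "j < q" "l < q" using uU by (cases u) (auto simp: U_def)
    have "\<alpha> ^ (j * \<mu>) = exp (of_nat (j * \<mu>) * \<omega>)" "\<gamma> ^ (l * \<mu>) = exp (of_nat (l * \<mu>) * (\<omega> * \<beta>))"
      unfolding \<alpha>_def \<gamma>_def by (simp_all only: exp_of_nat_mult)
    then have "\<alpha> ^ (j * \<mu>) * \<gamma> ^ (l * \<mu>) = exp (w u * of_nat \<mu>)"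
      by (simp add: exp_add[symmetric] w_def u(1) algebra_simps)
    moreover have "v s \<mu> u = \<delta> ^ (s + 2 * q * m)
        * ((of_nat j + of_nat l * \<beta>) ^ s * \<alpha> ^ (j * \<mu>) * \<gamma> ^ (l * \<mu>))"
      unfolding v_def u(1) prod.case by (rule monomial_scaling) (use u mu in auto)
    moreover have "w u ^ s = \<omega> ^ s * (of_nat j + of_nat l * \<beta>) ^ s"
      by (simp add: w_def u(1) power_mult_distrib)
    ultimately have "v s \<mu> u = \<delta> ^ (s + 2 * q * m) * ((of_nat j + of_nat l * \<beta>) ^ s * exp (w u * of_nat \<mu>))"
      and "w u ^ s = \<omega> ^ s * (of_nat j + of_nat l * \<beta>) ^ s" by (simp_all only: mult.assoc)
    then show ?thesis by (simp only: mult_ac)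
  qed
  have "\<exists>M :: complex \<Rightarrow> int. v s \<mu> u = (\<Sum>b\<in>X. of_int (M b) * b) \<and> (\<forall>b\<in>X. \<bar>M b\<bar> \<le> int (C s))"
    if u: "u \<in> U" "\<mu> < m" for s \<mu> u
  proof -
    obtain M where M: "\<And>b. b \<in> X \<Longrightarrow> v s \<mu> u * b = (\<Sum>b'\<in>X. of_int (M b b') * b')"
      "\<And>b. b \<in> X \<Longrightarrow> (\<Sum>b'\<in>X. \<bar>real_of_int (M b b')\<bar>) \<le> C s"
      using vnorm[OF u, of s] unfolding multiplier_norm_le_def by blast
    have "\<bar>M 1 b\<bar> \<le> int (C s)" if "b \<in> X" for b
    proof -
      have "\<bar>real_of_int (M 1 b)\<bar> \<le> (\<Sum>b'\<in>X. \<bar>real_of_int (M 1 b')\<bar>)"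
        using that X(1) by (intro member_le_sum) auto
      then have "\<bar>real_of_int (M 1 b)\<bar> \<le> C s" using M(2)[OF X(2)] by linarith
      then show ?thesis by linarith
    qed
    then show ?thesis using M(1)[OF X(2)] by (intro exI[of _ "M 1"]) simp
  qed
  note coordinates = this
  \<comment> \<open>coordinates in the module: since \<open>1\<close> is a generator, one row of a representing matrix suffices\<close>
  define M :: "nat \<Rightarrow> nat \<Rightarrow> nat \<times> nat \<Rightarrow> complex \<Rightarrow> int" where
    "M s \<mu> u = (SOME M. v s \<mu> u = (\<Sum>b\<in>X. of_int (M b) * b) \<and> (\<forall>b\<in>X. \<bar>M b\<bar> \<le> int (C s)))" for s \<mu> u
  have M: "v s \<mu> u = (\<Sum>b\<in>X. of_int (M s \<mu> u b) * b)" "\<And>b. b \<in> X \<Longrightarrow> \<bar>M s \<mu> u b\<bar> \<le> int (C s)"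
    if "u \<in> U" "\<mu> < m" for s \<mu> u
    using someI_ex[OF coordinates[OF that, of s]] unfolding M_def by blast+
  \<comment> \<open>the equations: one for each order, point and generator\<close>
  define E where "E = {..<n} \<times> {..<m} \<times> X"
  have cardU: "card U = q\<^sup>2" by (simp add: U_def power2_eq_square)
  obtain x :: "nat \<times> nat \<Rightarrow> int" where
    x: "\<And>e. e \<in> E \<Longrightarrow> (\<Sum>u\<in>U. (case e of (s, \<mu>, b) \<Rightarrow> M s \<mu> u b) * x u) = 0"
      "\<exists>u\<in>U. x u \<noteq> 0" "\<And>u. u \<in> U \<Longrightarrow> \<bar>x u\<bar> \<le> 2 * int (card U) * int (C n)"
  proof (rule siegel_lemma[of E U "\<lambda>e u. case e of (s, \<mu>, b) \<Rightarrow> M s \<mu> u b" "C n"])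
    show "finite E" "finite U" using X(1) by (auto simp: E_def U_def)
    show "U \<noteq> {}" using pos by (auto simp: U_def)
    show "card U = 2 * card E"
      unfolding cardU E_def card_cartesian_product h[symmetric] card_lessThan n_def q c power2_eq_square
      by (simp only: mult_ac)
    show "1 \<le> C n" by (rule C1)
    fix e u assume "e \<in> E" and u: "u \<in> U"
    then obtain s \<mu> b where e: "e = (s, \<mu>, b)" "s < n" "\<mu> < m" "b \<in> X"
      by (cases e) (auto simp: E_def)
    have "\<bar>M s \<mu> u b\<bar> \<le> int (C s)" by (rule M(2)[OF u e(3,4)])
    also have "\<dots> \<le> int (C n)" using Cmono[of s n] e(2) by simp
    finally show "\<bar>case e of (s, \<mu>, b) \<Rightarrow> M s \<mu> u b\<bar> \<le> int (C n)" by (simp add: e(1))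
  qed blast
  \<comment> \<open>the derivatives of the exponential sum at the points, scaled to be multipliers, and unscaled\<close>
  define T where "T s \<mu> = (\<Sum>u\<in>U. of_int (x u) * v s \<mu> u)" for s \<mu>
  define G where "G s a = (\<Sum>u\<in>U. of_int (x u) * w u ^ s * exp (w u * a))" for s a
  have TG: "\<omega> ^ s * T s \<mu> = \<delta> ^ (s + 2 * q * m) * G s (of_nat \<mu>)" if "\<mu> < m" for s \<mu>
  proof -
    have "\<omega> ^ s * T s \<mu> = (\<Sum>u\<in>U. of_int (x u) * (\<omega> ^ s * v s \<mu> u))"
      by (simp add: T_def sum_distrib_left mult_ac)
    also have "\<dots> = (\<Sum>u\<in>U. of_int (x u) * (\<delta> ^ (s + 2 * q * m) * (w u ^ s * exp (w u * of_nat \<mu>))))"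
      using vw[OF _ that] by (intro sum.cong) auto
    also have "\<dots> = \<delta> ^ (s + 2 * q * m) * G s (of_nat \<mu>)"
      unfolding G_def sum_distrib_left by (intro sum.cong) (simp_all add: mult_ac)
    finally show ?thesis .
  qed
  have \<delta>0: "\<delta> \<noteq> 0" using d by (simp add: \<delta>_def)
  have T_iff: "T s \<mu> = 0 \<longleftrightarrow> G s (of_nat \<mu>) = 0" if "\<mu> < m" for s \<mu>
  proof -
    have "T s \<mu> = 0 \<longleftrightarrow> \<omega> ^ s * T s \<mu> = 0" using \<omega> by simp
    also have "\<dots> \<longleftrightarrow> G s (of_nat \<mu>) = 0" unfolding TG[OF that] using \<delta>0 by simp
    finally show ?thesis .
  qed
  have Tzero: "T s \<mu> = 0" if "s < n" "\<mu> < m" for s \<mu>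
  proof -
    have "T s \<mu> = (\<Sum>u\<in>U. \<Sum>b\<in>X. of_int (M s \<mu> u b * x u) * b)"
      using M(1)[OF _ that(2)] by (simp add: T_def sum_distrib_left mult_ac)
    also have "\<dots> = (\<Sum>b\<in>X. of_int (\<Sum>u\<in>U. M s \<mu> u b * x u) * b)"
      by (subst sum.swap) (simp add: sum_distrib_right)
    also have "\<dots> = 0" using x(1)[of "(s, \<mu>, _)"] that by (intro sum.neutral) (auto simp: E_def)
    finally show ?thesis .
  qed
  have inj: "inj_on w U"
  proof (rule inj_onI, clarify)
    fix j l j' l' :: nat assume "w (j, l) = w (j', l')"
    then have eq: "of_nat j + of_nat l * \<beta> = of_nat j' + of_nat l' * \<beta>" using \<omega> by (simp add: w_def)
    have "l = l'"
    proof (rule ccontr)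
      assume ne: "l \<noteq> l'"
      have "(of_nat l - of_nat l') * \<beta> = of_nat j' - of_nat j" using eq by (simp add: algebra_simps)
      then have "\<beta> = (of_nat j' - of_nat j) / (of_nat l - of_nat l')"
        using ne by (simp add: field_simps)
      then show False using \<beta> by (metis Rats_diff Rats_divide Rats_of_nat)
    qed
    then show "j = j' \<and> l = l'" using eq by simp
  qed
  have "\<exists>s \<mu>. \<mu> < m \<and> T s \<mu> \<noteq> 0"
  proof (rule ccontr)
    assume "\<not> ?thesis"
    then have "G s 0 = 0" for s using T_iff[of 0 s] m by auto
    then have zero: "(\<Sum>u\<in>U. of_int (x u) * w u ^ s) = 0" for s by (simp add: G_def)
    have "finite U" by (simp add: U_def)
    then have "of_int (x u) = (0 :: complex)" if "u \<in> U" for u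
      using inj zero that by (rule power_sums_zero_imp_zero[of U w "\<lambda>u. of_int (x u)"])
    then show False using x(2) by auto
  qed
  then have ex: "\<exists>s. \<exists>\<mu><m. T s \<mu> \<noteq> 0" by blast
  define r where "r = (LEAST s. \<exists>\<mu><m. T s \<mu> \<noteq> 0)"
  have "\<exists>\<mu><m. T r \<mu> \<noteq> 0" unfolding r_def by (rule LeastI_ex[OF ex])
  then obtain \<mu> where \<mu>: "\<mu> < m" "T r \<mu> \<noteq> 0" by blast
  have below: "T s \<nu> = 0" if "s < r" "\<nu> < m" for s \<nu>
  proof -
    have "\<not> (\<exists>\<mu><m. T s \<mu> \<noteq> 0)" using that(1) unfolding r_def by (rule not_less_Least)
    then show ?thesis using that(2) by blast
  qed
  have rn: "n \<le> r" using Tzero[OF _ \<mu>(1), of r] \<mu>(2) not_le by blast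
  have xb: "\<bar>real_of_int (x u)\<bar> \<le> 2 * real q ^ 2 * C r" if "u \<in> U" for u
  proof -
    have "\<bar>real_of_int (x u)\<bar> \<le> real_of_int (2 * int (card U) * int (C n))"
      using x(3)[OF that] by linarith
    also have "\<dots> \<le> 2 * real q ^ 2 * C r" using Cmono[OF rn] by (simp add: cardU mult_left_mono)
    finally show ?thesis .
  qed
  have "multiplier_norm_le X (\<Sum>u\<in>U. 2 * real q ^ 2 * C r * C r) (T r \<mu>)"
    unfolding T_def
  proof (intro multiplier_norm_le_sum X multiplier_norm_le_mult vnorm \<mu>)
    fix u assume "u \<in> U"
    show "multiplier_norm_le X (2 * real q ^ 2 * C r) (of_int (x u))"
      using multiplier_norm_le_of_int[OF X(1)] xb[OF \<open>u \<in> U\<close>] by (rule multiplier_norm_le_mono)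
  qed auto
  then have mT: "multiplier_norm_le X (real q ^ 2 * (2 * real q ^ 2 * C r) * C r) (T r \<mu>)"
    by (simp add: cardU mult.assoc)
  show ?thesis
  proof
    show "r \<ge> c * k\<^sup>2" using rn by (simp add: n_def)
    have big: "1 \<le> real q ^ 2 * (2 * real q ^ 2 * C r) * C r"
    proof -
      have "1 \<le> q\<^sup>2 * (2 * q\<^sup>2 * C r) * C r" using pos C1[of r] by (simp add: Suc_le_eq)
      then have "real 1 \<le> real (q\<^sup>2 * (2 * q\<^sup>2 * C r) * C r)" by (simp only: of_nat_le_iff)
      then show ?thesis by simp
    qed
    from X(2) have "\<exists>b\<in>X. b \<noteq> 0" by (intro bexI[of _ 1]) auto
    from norm_multiplier_ge[OF X(1) this mT \<mu>(2) big]
    show "1 \<le> norm (T r \<mu>) * (real q ^ 2 * (2 * real q ^ 2 * ((2 * q * D) ^ r * D ^ (2 * q * m)))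
        * ((2 * q * D) ^ r * D ^ (2 * q * m))) ^ (h - 1)"
      unfolding h C_def by simp
    define R where "R = real r / real q"
    define S where "S = (of_nat ` {..<m} :: complex set)"
    have "n = q * k" by (simp add: n_def q power2_eq_square)
    then have "real q * real k \<le> real r" using rn by (simp flip: of_nat_mult)
    then have Rk: "R \<ge> real k" using pos by (simp add: R_def field_simps)
    have R0: "R > 0" using Rk pos by linarith
    have cardS: "card S = m" unfolding S_def by (subst card_image) (auto simp: inj_on_def)
    define W where "W = norm \<omega> * (real q * (1 + norm \<beta>))"
    have "norm (G r (of_nat \<mu>)) \<le> fact r * (real (card U) * (2 * real q ^ 2 * C r) * exp (W * R)) * (real m * 2 / R) ^ (r * card S)"
      unfolding G_def
    proof (rule exponential_sum_derivative_bound)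
      show "finite S" "of_nat \<mu> \<in> S" "0 < R" "1 \<le> real m" using \<mu> R0 m by (auto simp: S_def)
      show "(\<Sum>u\<in>U. of_int (x u) * w u ^ i * exp (w u * b)) = 0" if "i < r" and bS: "b \<in> S" for i b
      proof -
        obtain \<nu> where "\<nu> < m" "b = of_nat \<nu>" using bS by (auto simp: S_def)
        then have "G i b = 0" using below[OF \<open>i < r\<close>] T_iff by simp
        then show ?thesis by (simp only: G_def)
      qed
      show "norm b \<le> R / 2" if "b \<in> S" for b using that k Rk by (auto simp: S_def)
      show "norm (of_nat \<mu> - b) \<le> real m" if bS: "b \<in> S" for b
      proof -
        obtain \<nu> where \<nu>: "\<nu> < m" "b = of_nat \<nu>" using bS by (auto simp: S_def)
        have "norm (of_nat \<mu> - b) = \<bar>real \<mu> - real \<nu>\<bar>"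
          unfolding \<nu>(2) by (metis norm_of_real of_real_diff of_real_of_nat_eq real_norm_def)
        then show ?thesis using \<mu>(1) \<nu>(1) by auto
      qed
      show "norm (of_int (x u) :: complex) \<le> 2 * real q ^ 2 * C r" if "u \<in> U" for u
        using xb[OF that] by simp
      show "norm (w u) \<le> W" if uU: "u \<in> U" for u
      proof -
        obtain j l where u: "u = (j, l)" "j < q" "l < q" using uU by (cases u) (auto simp: U_def)
        have "norm (of_nat j + of_nat l * \<beta>) \<le> real j + real l * norm \<beta>"
          by (rule order_trans[OF norm_triangle_ineq]) (simp add: norm_mult)
        also have "\<dots> \<le> real q + real q * norm \<beta>" using u by (intro add_mono mult_right_mono) auto
        finally have "norm (of_nat j + of_nat l * \<beta>) \<le> real q * (1 + norm \<beta>)"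
          by (simp add: distrib_left)
        then have "norm \<omega> * norm (of_nat j + of_nat l * \<beta>) \<le> W"
          unfolding W_def by (rule mult_left_mono) simp
        then show ?thesis unfolding w_def u(1) prod.case norm_mult .
      qed
    qed
    moreover have "W * R = norm \<omega> * (1 + norm \<beta>) * r" using pos by (simp add: W_def R_def)
    moreover have "real m * 2 / R = 2 * m * q / r" by (simp add: R_def)
    ultimately have Gb: "norm (G r (of_nat \<mu>)) \<le> fact r * (real q ^ 2 * (2 * real q ^ 2 * C r)
        * exp (norm \<omega> * (1 + norm \<beta>) * r)) * (2 * m * q / r) ^ (r * m)" (is "_ \<le> ?Z")
      by (simp add: cardU cardS)
    have "norm \<omega> ^ r * norm (T r \<mu>) = norm \<delta> ^ (r + 2 * q * m) * norm (G r (of_nat \<mu>))"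
      using arg_cong[OF TG[OF \<mu>(1), of r], of norm] by (simp only: norm_mult norm_power)
    also have "\<dots> \<le> real D ^ (r + 2 * q * m) * ?Z"
    proof (intro mult_mono power_mono Gb)
      show "norm \<delta> \<le> real D" using d(2) by (simp add: \<delta>_def)
    qed auto
    finally show "norm (T r \<mu>) \<le> D ^ (r + 2 * q * m) / norm \<omega> ^ r * (fact r * (real q ^ 2 *
       (2 * real q ^ 2 * ((2 * q * D) ^ r * D ^ (2 * q * m)))
       * exp (norm \<omega> * (1 + norm \<beta>) * r)) * (2 * m * q / r) ^ (r * m))"
      using \<omega> unfolding C_def by (subst times_divide_eq_left) (simp add: pos_le_divide_eq mult.commute)
  qed
qed

text \<open>Since \<open>q\<^sup>2 \<le> c r\<close>, each factor in the two estimates is bounded by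
  an \<open>r\<close>-th power, and the \<open>r\<close>-th root of the combined inequality is
  \<open>1 \<le> K * q ^ (4 h + 1) / r ^ (2 h + 1)\<close>. The value \<open>m = 2 h + 2\<close> is
  large enough for the exponent of \<open>r\<close> to win: replacing \<open>q ^ (4 h)\<close> by
  \<open>(c r) ^ (2 h)\<close> leaves \<open>1 \<le> K * c ^ (2 h) * q / r\<close>.\<close>

lemma gelfond_exponent_comparison:
  fixes D a w N :: real and r q h m c :: nat
  assumes w: "w > 0" and D: "D \<ge> 1" and a: "a \<ge> 0"
    and h: "h \<ge> 1" and m: "m = 2 * h + 2" and c: "c \<ge> 1" and q: "q \<ge> 1" and qr: "q \<le> r" "q\<^sup>2 \<le> c * r"
    and low: "1 \<le> N * (real q ^ 2 * (2 * real q ^ 2 * ((2 * q * D) ^ r * D ^ (2 * q * m))) * ((2 * q * D) ^ r * D ^ (2 * q * m))) ^ (h - 1)"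
    and up: "N \<le> D ^ (r + 2 * q * m) / w ^ r * (fact r * (real q ^ 2 * (2 * real q ^ 2 * ((2 * q * D) ^ r * D ^ (2 * q * m)))
       * exp (a * r)) * (2 * m * q / r) ^ (r * m))"
  defines "K1 \<equiv> 2 * D ^ (1 + 2 * m)" and "K2 \<equiv> 8 * real c ^ 2"
  defines "K \<equiv> D ^ (1 + 2 * m) / w * (K2 * K1 * exp a * (2 * m) ^ m) * (K2 * K1\<^sup>2) ^ (h - 1)"
  shows "real r \<le> K * real c ^ (2 * h) * real q"
proof -
  have r: "r \<ge> 1" using q qr by simp
  have q0: "real q > 0" "real r > 0" using q r by auto
  have D0: "D > 0" using D by simp
  have Dp: "D ^ (2 * q * m) \<le> (D ^ (2 * m)) ^ r"
    unfolding power_mult[symmetric] using D qr(1) by (intro power_increasing) auto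
  have C: "(2 * q * D) ^ r * D ^ (2 * q * m) \<le> (K1 * q) ^ r"
  proof -
    have "(2 * q * D) ^ r * D ^ (2 * q * m) \<le> (2 * q * D) ^ r * (D ^ (2 * m)) ^ r"
      using Dp D0 by (intro mult_left_mono) auto
    also have "\<dots> = (K1 * q) ^ r" by (simp add: K1_def power_mult_distrib mult_ac)
    finally show ?thesis .
  qed
  have q4: "real q ^ 2 * (2 * real q ^ 2) \<le> K2 ^ r"
  proof -
    have q2: "real q ^ 2 \<le> real c * real r" using qr(2) by (simp flip: of_nat_mult of_nat_power)
    have "real r \<le> 2 ^ r" using of_nat_mono[OF less_imp_le[OF less_exp[of r]], where 'a = real] by simp
    then have r2: "real r * real r \<le> 2 ^ r * 2 ^ r" by (intro mult_mono) auto
    have "real q ^ 2 * (2 * real q ^ 2) \<le> (real c * real r) * (2 * (real c * real r))"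
      using q2 by (intro mult_mono) auto
    also have "\<dots> = 2 * real c ^ 2 * (real r * real r)" by (simp add: power2_eq_square)
    also have "\<dots> \<le> (2 * real c ^ 2) ^ r * (2 ^ r * 2 ^ r)"
    proof (intro mult_mono r2)
      have "1 \<le> real c ^ 2" using c by (intro one_le_power) simp
      then show "2 * real c ^ 2 \<le> (2 * real c ^ 2) ^ r"
        using r by (intro self_le_power) auto
    qed auto
    also have "\<dots> = (2 * real c ^ 2 * (2 * 2)) ^ r" by (simp only: power_mult_distrib)
    also have "\<dots> = K2 ^ r" by (simp add: K2_def mult_ac)
    finally show ?thesis .
  qed
  have K10: "K1 > 0" using D0 by (simp add: K1_def)
  have K20: "K2 > 0" using c by (simp add: K2_def)
  have A: "real q ^ 2 * (2 * real q ^ 2 * ((2 * q * D) ^ r * D ^ (2 * q * m))) \<le> (K2 * (K1 * q)) ^ r"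
    using mult_mono[OF q4 C] D0 K20 unfolding power_mult_distrib[of K2] by (simp add: mult.assoc)
  have B: "real q ^ 2 * (2 * real q ^ 2 * ((2 * q * D) ^ r * D ^ (2 * q * m))) * ((2 * q * D) ^ r * D ^ (2 * q * m))
      \<le> (K2 * K1\<^sup>2 * real q ^ 2) ^ r"
  proof -
    have e: "K2 * K1\<^sup>2 * real q ^ 2 = (K2 * (K1 * q)) * (K1 * q)" by (simp add: power2_eq_square)
    show ?thesis
      unfolding e power_mult_distrib[of "K2 * (K1 * q)" "K1 * q"]
      by (rule mult_mono[OF A C]) (use D0 K10 K20 in auto)
  qed
  have N0: "N > 0"
  proof (rule ccontr)
    assume "\<not> N > 0"
    then have "N * (real q ^ 2 * (2 * real q ^ 2 * ((2 * q * D) ^ r * D ^ (2 * q * m))) * ((2 * q * D) ^ r * D ^ (2 * q * m))) ^ (h - 1) \<le> 0"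
      using D0 by (intro mult_nonpos_nonneg) auto
    then show False using low by simp
  qed
  have fact: "fact r \<le> real r ^ r" using fact_le_power[of r, where ?'a = real] by simp
  have "1 \<le> N * ((K2 * K1\<^sup>2 * real q ^ 2) ^ r) ^ (h - 1)"
    using N0 D0 by (intro order_trans[OF low] mult_left_mono power_mono B) auto
  also have "\<dots> = N * ((K2 * K1\<^sup>2 * real q ^ 2) ^ (h - 1)) ^ r"
    by (simp add: power_mult[symmetric] mult.commute)
  also have "N \<le> (D ^ (1 + 2 * m) / w) ^ r * (real r ^ r * (K2 * (K1 * q)) ^ r * exp a ^ r * ((2 * m * q / r) ^ m) ^ r)"
  proof (rule order_trans[OF up])
    have p1: "D ^ (r + 2 * q * m) / w ^ r \<le> (D ^ (1 + 2 * m) / w) ^ r"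
      using mult_left_mono[OF Dp, of "D ^ r"] D0 w
      by (simp add: power_add power_mult_distrib power_divide divide_right_mono)
    have p2: "fact r * (real q ^ 2 * (2 * real q ^ 2 * ((2 * q * D) ^ r * D ^ (2 * q * m))) * exp (a * r)) * (2 * m * q / r) ^ (r * m)
      \<le> real r ^ r * ((K2 * (K1 * q)) ^ r * exp a ^ r) * ((2 * m * q / r) ^ m) ^ r"
      using fact A D0 K10 K20 q0
      by (intro mult_mono) (auto simp: power_mult[symmetric] mult.commute exp_of_nat_mult[symmetric])
    show "D ^ (r + 2 * q * m) / w ^ r * (fact r * (real q ^ 2 * (2 * real q ^ 2 * ((2 * q * D) ^ r * D ^ (2 * q * m)))
       * exp (a * r)) * (2 * m * q / r) ^ (r * m))
      \<le> (D ^ (1 + 2 * m) / w) ^ r * (real r ^ r * (K2 * (K1 * q)) ^ r * exp a ^ r * ((2 * m * q / r) ^ m) ^ r)"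
      using mult_mono[OF p1 p2] D0 w by (simp add: mult.assoc)
  qed
  also have "\<dots> * ((K2 * K1\<^sup>2 * real q ^ 2) ^ (h - 1)) ^ r =
      (D ^ (1 + 2 * m) / w * (real r * (K2 * (K1 * q)) * exp a * (2 * m * q / r) ^ m) * (K2 * K1\<^sup>2 * real q ^ 2) ^ (h - 1)) ^ r"
    by (simp only: power_mult_distrib)
  finally have "1 \<le> (D ^ (1 + 2 * m) / w * (real r * (K2 * (K1 * q)) * exp a * (2 * m * q / r) ^ m) * (K2 * K1\<^sup>2 * real q ^ 2) ^ (h - 1)) ^ r"
    (is "1 \<le> ?base ^ r") using K10 K20 by (auto simp: mult_right_mono)
  moreover have "?base \<ge> 0" using D0 w K10 K20 by auto
  ultimately have "1 \<le> ?base" using r power_strict_mono[of ?base 1 r] by (cases "?base < 1") auto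
  also have "?base = K * (real r * real q * (real q / real r) ^ m * (real q ^ 2) ^ (h - 1))"
    unfolding K_def by (simp add: power_mult_distrib power_divide)
  also have "real r * real q * (real q / real r) ^ m * (real q ^ 2) ^ (h - 1) = (real q ^ 2) ^ (2 * h) * real q / real r ^ (2 * h + 1)"
  proof -
    obtain h' where h': "h = Suc h'" using h by (cases h) auto
    show ?thesis using q0 unfolding m h'
      by (simp add: power_divide power_mult[symmetric] field_simps power_add[symmetric])
  qed
  also have "K * \<dots> \<le> K * ((real c * real r) ^ (2 * h) * real q / real r ^ (2 * h + 1))"
  proof (intro mult_left_mono divide_right_mono mult_right_mono power_mono)
    show "real q ^ 2 \<le> real c * real r" using qr(2) by (simp flip: of_nat_mult of_nat_power)
    show "0 \<le> K" unfolding K_def using D0 w K10 K20 by auto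
  qed auto
  also have "\<dots> = K * real c ^ (2 * h) * real q / real r"
    using q0 by (simp add: power_mult_distrib field_simps)
  finally show ?thesis using q0 by (simp add: field_simps)
qed

text \<open>The Gelfond-Schneider theorem, with the logarithm \<open>\<omega>\<close> of the base as
  parameter, so that no branch has to be chosen. For irrational \<open>\<beta>\<close> the estimates
  yield \<open>r \<le> K * c ^ (2 h) * q\<close> with a constant \<open>K\<close> that does not
  depend on \<open>k\<close>. But \<open>r \<ge> q * k\<close>, which is a contradiction once
  \<open>k\<close> exceeds \<open>K * c ^ (2 h)\<close>.\<close>

theorem gelfond_schneider:
  fixes \<omega> \<beta> :: complex
  assumes \<omega>: "\<omega> \<noteq> 0" and alg: "algebraic \<beta>" "algebraic (exp \<omega>)" "algebraic (exp (\<omega> * \<beta>))"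
  shows "\<beta> \<in> \<rat>"
proof (rule ccontr)
  assume \<beta>: "\<beta> \<notin> \<rat>"
  define S where "S = {\<beta>, exp \<omega>, exp (\<omega> * \<beta>)}"
  obtain X and d :: int where X: "finite X" "1 \<in> X" "d \<noteq> 0"
    and mult: "\<And>y. y \<in> S \<Longrightarrow> multiplier X (of_int d * y)"
    using common_multiplier_module[of S] alg by (auto simp: S_def)
  have "\<forall>y\<in>S. \<exists>B. multiplier_norm_le X B (of_int d * y)"
    using multiplier_imp_norm_le[OF X(1)] mult by metis
  then obtain B where B: "\<And>y. y \<in> S \<Longrightarrow> multiplier_norm_le X (B y) (of_int d * y)" by metis
  define B' where "B' = max \<bar>real_of_int d\<bar> (Max (B ` S))"
  obtain D :: nat where D: "B' \<le> real D" using real_arch_simple by blast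
  have dD: "\<bar>d\<bar> \<le> int D" using D unfolding B'_def by linarith
  then have D1: "D \<ge> 1" using X(3) by linarith
  have BD: "multiplier_norm_le X D (of_int d * y)" if "y \<in> S" for y
  proof (rule multiplier_norm_le_mono[OF B[OF that]])
    have "B y \<le> Max (B ` S)" using that by (intro Max_ge) (auto simp: S_def)
    then show "B y \<le> D" using D by (simp add: B'_def)
  qed
  have dD': "multiplier_norm_le X D (of_int d)"
    by (rule multiplier_norm_le_mono[OF multiplier_norm_le_of_int[OF X(1)]]) (use dD in linarith)
  define h where "h = card X"
  define m where "m = 2 * h + 2"
  define c where "c = 2 * m * h"
  have h1: "h \<ge> 1" using X by (auto simp: h_def Suc_le_eq card_gt_0_iff)
  have m1: "m \<ge> 1" by (simp add: m_def)
  have c1: "c \<ge> 1" using h1 m1 by (simp add: c_def Suc_le_eq)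
  define a where "a = norm \<omega> * (1 + norm \<beta>)"
  define K where "K = real D ^ (1 + 2 * m) / norm \<omega> * (8 * real c ^ 2 * (2 * real D ^ (1 + 2 * m)) * exp a * (2 * m) ^ m)
    * (8 * real c ^ 2 * (2 * real D ^ (1 + 2 * m))\<^sup>2) ^ (h - 1)"
  \<comment> \<open>all constants so far are independent of the parameter \<open>k\<close>\<close>
  obtain k0 :: nat where k0: "K * real c ^ (2 * h) < real k0" using reals_Archimedean2 by blast
  define k where "k = max (2 * m) k0"
  have k: "k \<ge> 2 * m" "K * real c ^ (2 * h) < real k" using k0 by (auto simp: k_def)
  define q where "q = c * k"
  have q1: "q \<ge> 1" using c1 k(1) m1 by (simp add: q_def Suc_le_eq)
  obtain r :: nat and N :: real where r: "r \<ge> c * k\<^sup>2"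
    and low: "1 \<le> N * (real q ^ 2 * (2 * real q ^ 2 * ((2 * q * D) ^ r * D ^ (2 * q * m))) * ((2 * q * D) ^ r * D ^ (2 * q * m))) ^ (h - 1)"
    and up: "N \<le> D ^ (r + 2 * q * m) / norm \<omega> ^ r * (fact r * (real q ^ 2 * (2 * real q ^ 2 * ((2 * q * D) ^ r * D ^ (2 * q * m)))
       * exp (norm \<omega> * (1 + norm \<beta>) * r)) * (2 * m * q / r) ^ (r * m))"
    using gelfond_inequalities[OF X(1,2,3) dD D1 dD' BD BD BD \<omega> \<beta> h_def m1 c_def k(1) q_def]
    by (auto simp: S_def)
  have qk: "q * k \<le> r" using r by (simp add: q_def power2_eq_square)
  have "real r \<le> K * real c ^ (2 * h) * real q"
    unfolding K_def
  proof (rule gelfond_exponent_comparison[where m = m and a = a and w = "norm \<omega>"])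
    show "q \<le> r" using qk k(1) m1 by (intro order_trans[OF _ qk]) auto
    have "q\<^sup>2 = c * (q * k)" by (simp add: q_def power2_eq_square)
    then show "q\<^sup>2 \<le> c * r" using qk by simp
  qed (use \<omega> D1 h1 c1 q1 low up in \<open>simp_all add: m_def a_def\<close>)
  also have "\<dots> < real k * real q" using k(2) q1 by (intro mult_strict_right_mono) auto
  also have "\<dots> \<le> real r" using qk by (simp add: mult.commute flip: of_nat_mult)
  finally show False by simp
qed

section \<open>Eigenprojections of Hermitian matrices\<close>

lemma mat_eqI_mult_vec:
  fixes P Q :: "complex mat"
  assumes P: "P \<in> carrier_mat n n" and Q: "Q \<in> carrier_mat n n"
    and eq: "\<And>v. v \<in> carrier_vec n \<Longrightarrow> P *\<^sub>v v = Q *\<^sub>v v"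
  shows "P = Q"
proof (rule eq_matI)
  fix i j assume "i < dim_row Q" "j < dim_col Q"
  then have i: "i < n" and j: "j < n" using Q by auto
  have "(P *\<^sub>v unit_vec n j) $ i = (Q *\<^sub>v unit_vec n j) $ i" using eq by simp
  then show "P $$ (i, j) = Q $$ (i, j)" using i j P Q by simp
qed (use P Q in auto)

lemma zero_mat_mult_vec: "(v :: complex vec) \<in> carrier_vec n \<Longrightarrow> 0\<^sub>m n n *\<^sub>v v = 0\<^sub>v n"
  by (intro eq_vecI) (auto simp: scalar_prod_def)

lemma hermitian_mat_entry:
  assumes A: "A \<in> carrier_mat n n" and herm: "hermitian_mat A" and ij: "i < n" "j < n"
  shows "A $$ (i, j) = cnj (A $$ (j, i))"
proof -
  have "A $$ (i, j) = mat_adjoint A $$ (i, j)" using herm by (simp add: hermitian_mat_def)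
  also have "\<dots> = cnj (A $$ (j, i))" using A ij by (simp add: mat_adjoint_def mat_of_rows_def)
  finally show ?thesis .
qed

lemma hermitian_mat_cscalar_prod:
  assumes A: "A \<in> carrier_mat n n" and herm: "hermitian_mat A"
    and v: "v \<in> carrier_vec n" and w: "w \<in> carrier_vec n"
  shows "(A *\<^sub>v v) \<bullet>c w = v \<bullet>c (A *\<^sub>v w)"
proof -
  have Av: "(A *\<^sub>v u) $ i = (\<Sum>j<n. A $$ (i, j) * u $ j)" if "u \<in> carrier_vec n" "i < n" for u i
    using that A by (auto simp: scalar_prod_def lessThan_atLeast0 intro!: sum.cong)
  have Aw: "A *\<^sub>v w \<in> carrier_vec n" using A w by simp
  have "(A *\<^sub>v v) \<bullet>c w = (\<Sum>i<n. \<Sum>j<n. A $$ (i, j) * v $ j * cnj (w $ i))"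
    unfolding cscalar_prod_eq_sum[OF w] using Av[OF v]
    by (intro sum.cong) (simp_all add: sum_distrib_right del: index_mult_mat_vec)
  also have "\<dots> = (\<Sum>j<n. \<Sum>i<n. A $$ (i, j) * v $ j * cnj (w $ i))" by (rule sum.swap)
  also have "\<dots> = (\<Sum>j<n. v $ j * cnj ((A *\<^sub>v w) $ j))"
  proof (rule sum.cong[OF refl])
    fix j assume "j \<in> {..<n}"
    then have j: "j < n" by simp
    show "(\<Sum>i<n. A $$ (i, j) * v $ j * cnj (w $ i)) = v $ j * cnj ((A *\<^sub>v w) $ j)"
      unfolding Av[OF w j] cnj_sum sum_distrib_left
      using hermitian_mat_entry[OF A herm _ j] by (intro sum.cong) (simp_all add: mult_ac)
  qed
  also have "\<dots> = v \<bullet>c (A *\<^sub>v w)" by (rule cscalar_prod_eq_sum[OF Aw, symmetric])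
  finally show ?thesis .
qed

lemma eigenspace_subset_carrier: "A \<in> carrier_mat n n \<Longrightarrow> eigenspace A \<theta> \<subseteq> carrier_vec n"
  by (auto simp: eigenspace_def)

lemma eigenprojection_carrier: "A \<in> carrier_mat n n \<Longrightarrow> eigenprojection A \<theta> \<in> carrier_mat n n"
  using is_orthogonal_projection_eigenprojection[of A n \<theta>] by (simp add: is_orthogonal_projection_def)

text \<open>The difference of \<open>w\<close> and the projection of \<open>v\<close> lies in the
  eigenspace and is orthogonal to it.\<close>

lemma eigenprojection_eqI:
  assumes A: "A \<in> carrier_mat n n" and v: "v \<in> carrier_vec n" and w: "w \<in> eigenspace A \<theta>"
    and orth: "\<And>u. u \<in> eigenspace A \<theta> \<Longrightarrow> (v - w) \<bullet>c u = 0"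
  shows "eigenprojection A \<theta> *\<^sub>v v = w"
proof -
  let ?E = "eigenprojection A \<theta>"
  note P = is_orthogonal_projection_eigenprojection[OF A, of \<theta>]
  have E: "?E *\<^sub>v v \<in> eigenspace A \<theta>" using P v by (simp add: is_orthogonal_projection_def)
  have c: "?E *\<^sub>v v \<in> carrier_vec n" "w \<in> carrier_vec n"
    using E w eigenspace_subset_carrier[OF A] by auto
  define e where "e = ?E *\<^sub>v v"
  have ec: "e \<in> carrier_vec n" using c by (simp add: e_def)
  define x where "x = e - w"
  have xc: "x \<in> carrier_vec n" using c by (simp add: x_def e_def)
  have Ae: "A *\<^sub>v e = \<theta> \<cdot>\<^sub>v e" "A *\<^sub>v w = \<theta> \<cdot>\<^sub>v w" using E w by (auto simp: eigenspace_def e_def)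
  have "A *\<^sub>v x = \<theta> \<cdot>\<^sub>v x"
  proof (rule eq_vecI)
    fix i assume "i < dim_vec (\<theta> \<cdot>\<^sub>v x)"
    then have i: "i < n" using xc by simp
    have "A *\<^sub>v x = A *\<^sub>v e - A *\<^sub>v w"
      unfolding x_def using A ec c(2) by (rule mult_minus_distrib_mat_vec)
    then show "(A *\<^sub>v x) $ i = (\<theta> \<cdot>\<^sub>v x) $ i"
      using i ec c(2) unfolding Ae by (simp add: x_def right_diff_distrib)
  qed (use A xc in auto)
  then have xW: "x \<in> eigenspace A \<theta>" using A xc by (simp add: eigenspace_def)
  have "(v - e) \<bullet>c x = 0" using P v xW unfolding is_orthogonal_projection_def e_def by blast
  moreover have "(v - w) \<bullet>c x = 0" using orth[OF xW] .
  moreover have "x \<bullet>c x = (v - w) \<bullet>c x - (v - e) \<bullet>c x"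
  proof -
    have "(v - w) - (v - e) = x" using v c ec by (auto simp: x_def)
    moreover have "((v - w) - (v - e)) \<bullet>c x = (v - w) \<bullet>c x - (v - e) \<bullet>c x"
      using v c ec xc by (intro minus_scalar_prod_distrib[of _ n]) auto
    ultimately show ?thesis by simp
  qed
  ultimately have "x \<bullet>c x = 0" by simp
  then have "x = 0\<^sub>v n" using conjugate_square_eq_0_vec[OF xc] by simp
  have "e = w"
  proof (rule eq_vecI)
    fix i assume "i < dim_vec w"
    then have i: "i < n" using c(2) by simp
    have "(e - w) $ i = 0" using \<open>x = 0\<^sub>v n\<close> i by (simp add: x_def)
    then show "e $ i = w $ i" using i c(2) by simp
  qed (use ec c(2) in simp)
  then show ?thesis by (simp add: e_def)
qed

text \<open>The second equation holds because \<open>A\<close>, being Hermitian and preserving the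
  eigenspace, also preserves its orthogonal complement.\<close>

lemma eigenprojection_mult:
  assumes A: "A \<in> carrier_mat n n" and herm: "hermitian_mat A"
  shows mult_eigenprojection: "A * eigenprojection A \<theta> = \<theta> \<cdot>\<^sub>m eigenprojection A \<theta>"
    and eigenprojection_mult_mat: "eigenprojection A \<theta> * A = \<theta> \<cdot>\<^sub>m eigenprojection A \<theta>"
proof -
  let ?E = "eigenprojection A \<theta>"
  note P = is_orthogonal_projection_eigenprojection[OF A, of \<theta>]
  note E = eigenprojection_carrier[OF A, of \<theta>]
  have Ev: "?E *\<^sub>v v \<in> eigenspace A \<theta>" if "v \<in> carrier_vec n" for v
    using P that by (simp add: is_orthogonal_projection_def)
  have smult: "(\<theta> \<cdot>\<^sub>m ?E) *\<^sub>v v = \<theta> \<cdot>\<^sub>v (?E *\<^sub>v v)" if "v \<in> carrier_vec n" for v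
    using E that by (intro eq_vecI) auto
  show "A * ?E = \<theta> \<cdot>\<^sub>m ?E"
  proof (rule mat_eqI_mult_vec[of _ n])
    fix v :: "complex vec" assume v: "v \<in> carrier_vec n"
    have "(A * ?E) *\<^sub>v v = A *\<^sub>v (?E *\<^sub>v v)" using A E v by (rule assoc_mult_mat_vec)
    also have "\<dots> = \<theta> \<cdot>\<^sub>v (?E *\<^sub>v v)" using Ev[OF v] by (simp add: eigenspace_def)
    finally show "(A * ?E) *\<^sub>v v = (\<theta> \<cdot>\<^sub>m ?E) *\<^sub>v v" using smult[OF v] by simp
  qed (use A E in auto)
  show "?E * A = \<theta> \<cdot>\<^sub>m ?E"
  proof (rule mat_eqI_mult_vec[of _ n])
    fix v :: "complex vec" assume v: "v \<in> carrier_vec n"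
    define e where "e = ?E *\<^sub>v v"
    have e: "e \<in> eigenspace A \<theta>" using Ev[OF v] by (simp add: e_def)
    then have ec: "e \<in> carrier_vec n" and Ae: "A *\<^sub>v e = \<theta> \<cdot>\<^sub>v e"
      using A by (auto simp: eigenspace_def)
    have "(?E * A) *\<^sub>v v = ?E *\<^sub>v (A *\<^sub>v v)" using E A v by (rule assoc_mult_mat_vec)
    also have "\<dots> = \<theta> \<cdot>\<^sub>v e"
    proof (rule eigenprojection_eqI[OF A])
      show "A *\<^sub>v v \<in> carrier_vec n" using A v by simp
      show "\<theta> \<cdot>\<^sub>v e \<in> eigenspace A \<theta>"
        using A ec Ae by (simp add: eigenspace_def mult_mat_vec[OF A])
      fix u assume u: "u \<in> eigenspace A \<theta>"
      then have uc: "u \<in> carrier_vec n" and Au: "A *\<^sub>v u = \<theta> \<cdot>\<^sub>v u"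
        using A by (auto simp: eigenspace_def)
      have vu: "(v - e) \<bullet>c u = 0"
        using P v u unfolding is_orthogonal_projection_def e_def by blast
      have diff: "A *\<^sub>v v - \<theta> \<cdot>\<^sub>v e = A *\<^sub>v (v - e)"
        unfolding Ae[symmetric] using A v ec by (rule mult_minus_distrib_mat_vec[symmetric])
      have "(A *\<^sub>v v - \<theta> \<cdot>\<^sub>v e) \<bullet>c u = (v - e) \<bullet>c (A *\<^sub>v u)"
        unfolding diff using v ec uc by (intro hermitian_mat_cscalar_prod[OF A herm]) auto
      also have "\<dots> = cnj \<theta> * ((v - e) \<bullet>c u)"
        unfolding Au using v ec uc by (simp add: conjugate_smult_vec)
      finally show "(A *\<^sub>v v - \<theta> \<cdot>\<^sub>v e) \<bullet>c u = 0" using vu by simp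
    qed
    finally show "(?E * A) *\<^sub>v v = (\<theta> \<cdot>\<^sub>m ?E) *\<^sub>v v" using smult[OF v] by (simp add: e_def)
  qed (use A E in auto)
qed

section \<open>The matrix exponential on eigenspaces\<close>

lemma smult_smult_mat: "a \<cdot>\<^sub>m (b \<cdot>\<^sub>m (M :: complex mat)) = (a * b) \<cdot>\<^sub>m M"
  by (rule eq_matI) auto

text \<open>Every power of \<open>M\<close> acts on \<open>B\<close> as the scalar \<open>\<mu> ^
  k\<close>, so the exponential series can be summed entrywise.\<close>

lemma mat_exp_mult_eigen:
  assumes M: "M \<in> carrier_mat n n" and B: "B \<in> carrier_mat n n" and eq: "M * B = \<mu> \<cdot>\<^sub>m B"
  shows "mat_exp M * B = exp \<mu> \<cdot>\<^sub>m B"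
proof -
  have pow: "M ^\<^sub>m k * B = \<mu> ^ k \<cdot>\<^sub>m B" for k
  proof (induction k)
    case 0
    show ?case using M B by auto
  next
    case (Suc k)
    have "M ^\<^sub>m Suc k * B = M ^\<^sub>m k * (M * B)"
      unfolding pow_mat.simps by (rule assoc_mult_mat[OF pow_carrier_mat[OF M] M B])
    also have "\<dots> = \<mu> \<cdot>\<^sub>m (M ^\<^sub>m k * B)" unfolding eq by (rule mult_smult_distrib[OF pow_carrier_mat[OF M] B])
    finally show ?case unfolding Suc by (simp add: smult_smult_mat)
  qed
  show ?thesis
  proof (rule eq_matI)
    fix i j assume "i < dim_row (exp \<mu> \<cdot>\<^sub>m B)" "j < dim_col (exp \<mu> \<cdot>\<^sub>m B)"
    then have ij: "i < n" "j < n" using B by auto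
    have "(\<lambda>k. (\<Sum>l<n. (M ^\<^sub>m k) $$ (i, l) / fact k * B $$ (l, j))) sums
        (\<Sum>l<n. (\<Sum>k. (M ^\<^sub>m k) $$ (i, l) / fact k) * B $$ (l, j))"
      by (intro sums_sum sums_mult2 summable_sums summable_mat_exp[OF M ij(1)]) simp
    also have "(\<lambda>k. (\<Sum>l<n. (M ^\<^sub>m k) $$ (i, l) / fact k * B $$ (l, j))) = (\<lambda>k. \<mu> ^ k /\<^sub>R fact k * B $$ (i, j))"
    proof
      fix k
      have "(\<Sum>l<n. (M ^\<^sub>m k) $$ (i, l) / fact k * B $$ (l, j))
          = (\<Sum>l<n. (M ^\<^sub>m k) $$ (i, l) * B $$ (l, j)) / fact k"
        by (simp add: sum_divide_distrib)
      also have "(\<Sum>l<n. (M ^\<^sub>m k) $$ (i, l) * B $$ (l, j)) = (M ^\<^sub>m k * B) $$ (i, j)"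
        using pow_carrier_mat[OF M] M B ij by (auto simp: scalar_prod_def lessThan_atLeast0 intro!: sum.cong)
      also have "\<dots> = \<mu> ^ k * B $$ (i, j)" unfolding pow using B ij by simp
      finally show "(\<Sum>l<n. (M ^\<^sub>m k) $$ (i, l) / fact k * B $$ (l, j)) = \<mu> ^ k /\<^sub>R fact k * B $$ (i, j)"
        by (simp add: scaleR_conv_of_real divide_inverse mult_ac)
    qed
    finally have "(\<Sum>l<n. (\<Sum>k. (M ^\<^sub>m k) $$ (i, l) / fact k) * B $$ (l, j)) = exp \<mu> * B $$ (i, j)"
      by (rule sums_unique2[OF _ sums_mult2[OF exp_converges]])
    moreover have "(mat_exp M * B) $$ (i, j) = (\<Sum>l<n. (\<Sum>k. (M ^\<^sub>m k) $$ (i, l) / fact k) * B $$ (l, j))"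
      using M B ij by (auto simp: mat_exp_def scalar_prod_def lessThan_atLeast0 intro!: sum.cong)
    ultimately show "(mat_exp M * B) $$ (i, j) = (exp \<mu> \<cdot>\<^sub>m B) $$ (i, j)" using B ij by simp
  qed (use M B in \<open>auto simp: mat_exp_def\<close>)
qed

lemma transpose_pow_mat:
  fixes M :: "complex mat"
  assumes M: "M \<in> carrier_mat n n"
  shows "transpose_mat M ^\<^sub>m k = transpose_mat (M ^\<^sub>m k)"
proof (induction k)
  case 0
  show ?case using M by simp
next
  case (Suc k)
  have comm: "M * M ^\<^sub>m k = M ^\<^sub>m k * M"
  proof (induction k)
    case (Suc k)
    have "M * (M ^\<^sub>m k * M) = M * M ^\<^sub>m k * M" using M by (simp add: assoc_mult_mat[of _ n n _ n _ n])
    then show ?case using Suc by simp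
  qed (use M in auto)
  have "transpose_mat M ^\<^sub>m Suc k = transpose_mat (M ^\<^sub>m k) * transpose_mat M" by (simp add: Suc)
  also have "\<dots> = transpose_mat (M * M ^\<^sub>m k)" using M by (intro transpose_mult[symmetric]) auto
  finally show ?case by (simp add: comm)
qed

lemma eigen_mult_mat_exp:
  assumes M: "M \<in> carrier_mat n n" and B: "B \<in> carrier_mat n n" and eq: "B * M = \<mu> \<cdot>\<^sub>m B"
  shows "B * mat_exp M = exp \<mu> \<cdot>\<^sub>m B"
proof -
  have "transpose_mat M * transpose_mat B = transpose_mat (B * M)"
    using transpose_mult[OF B M] by simp
  also have "\<dots> = \<mu> \<cdot>\<^sub>m transpose_mat B" unfolding eq by (rule eq_matI) (use B in auto)
  finally have "mat_exp (transpose_mat M) * transpose_mat B = exp \<mu> \<cdot>\<^sub>m transpose_mat B"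
    using M B by (intro mat_exp_mult_eigen[of _ n]) auto
  moreover have "mat_exp (transpose_mat M) = transpose_mat (mat_exp M)"
    by (rule eq_matI) (use M in \<open>auto simp: mat_exp_def transpose_pow_mat[OF M]\<close>)
  moreover have "mat_exp M \<in> carrier_mat n n" using M by (simp add: mat_exp_def)
  ultimately have "transpose_mat (B * mat_exp M) = exp \<mu> \<cdot>\<^sub>m transpose_mat B"
    using transpose_mult[OF B, of "mat_exp M" n] by simp
  then have "transpose_mat (transpose_mat (B * mat_exp M)) = transpose_mat (exp \<mu> \<cdot>\<^sub>m transpose_mat B)"
    by simp
  also have "\<dots> = exp \<mu> \<cdot>\<^sub>m B" by (rule eq_matI) (use B in auto)
  finally show ?thesis by simp
qed

text \<open>The left eigenprojection turns the matrix \<open>U(t)\<close> to its right into a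
  scalar, and the right one does the same to \<open>U(-t)\<close>.\<close>

lemma eigenprojection_state_at:
  assumes A: "A \<in> carrier_mat n n" and herm: "hermitian_mat A" and D: "D \<in> carrier_mat n n"
  shows "eigenprojection A \<theta> * state_at A D t * eigenprojection A \<eta>
    = exp (\<i> * of_real t * (\<theta> - \<eta>)) \<cdot>\<^sub>m (eigenprojection A \<theta> * D * eigenprojection A \<eta>)"
proof -
  let ?E = "eigenprojection A \<theta>" and ?F = "eigenprojection A \<eta>"
  define U where "U = transition_mat A t"
  define V where "V = transition_mat A (- t)"
  define a where "a = exp (\<i> * of_real t * \<theta>)"
  define b where "b = exp (- (\<i> * of_real t * \<eta>))"
  note E = eigenprojection_carrier[OF A, of \<theta>] and F = eigenprojection_carrier[OF A, of \<eta>]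
  have UV: "U \<in> carrier_mat n n" "V \<in> carrier_mat n n"
    using A by (auto simp: U_def V_def transition_mat_def mat_exp_def)
  have EU: "?E * U = a \<cdot>\<^sub>m ?E"
    unfolding U_def transition_mat_def a_def
  proof (rule eigen_mult_mat_exp[OF _ E])
    show "?E * ((\<i> * of_real t) \<cdot>\<^sub>m A) = (\<i> * of_real t * \<theta>) \<cdot>\<^sub>m ?E"
      using mult_smult_distrib[OF E A] eigenprojection_mult_mat[OF A herm] by (simp add: smult_smult_mat)
  qed (use A in simp)
  have VF: "V * ?F = b \<cdot>\<^sub>m ?F"
    unfolding V_def transition_mat_def b_def
  proof (rule mat_exp_mult_eigen[OF _ F])
    show "(\<i> * of_real (- t)) \<cdot>\<^sub>m A * ?F = (- (\<i> * of_real t * \<eta>)) \<cdot>\<^sub>m ?F"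
      using mult_smult_assoc_mat[OF A F] mult_eigenprojection[OF A herm] by (simp add: smult_smult_mat)
  qed (use A in simp)
  note assoc = assoc_mult_mat[of _ n n _ n _ n]
  have "?E * (U * D * V) * ?F = (?E * U) * D * (V * ?F)"
    using E F D UV by (simp add: assoc)
  also have "\<dots> = (a * b) \<cdot>\<^sub>m (?E * D * ?F)"
    unfolding EU VF using E F D
    by (simp add: mult_smult_assoc_mat[of _ n n _ n] mult_smult_distrib[of _ n n _ n] smult_smult_mat mult.commute)
  also have "a * b = exp (\<i> * of_real t * (\<theta> - \<eta>))"
    by (simp add: a_def b_def exp_add[symmetric] right_diff_distrib)
  finally show ?thesis by (simp add: state_at_def U_def V_def)
qed

section \<open>Completeness of the eigenspaces\<close>

text \<open>The value at \<open>A\<close> of the polynomial with roots \<open>es\<close>: the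
  product of the matrices \<open>A - e\<close> in the order of the list.\<close>

definition shift_prod :: "complex mat \<Rightarrow> complex list \<Rightarrow> complex mat" where
  "shift_prod A es = foldr (\<lambda>e B. char_matrix A e * B) es (1\<^sub>m (dim_row A))"

lemma shift_prod_simps:
  "shift_prod A [] = 1\<^sub>m (dim_row A)"
  "shift_prod A (e # es) = char_matrix A e * shift_prod A es"
  by (simp_all add: shift_prod_def)

lemma shift_prod_carrier: "A \<in> carrier_mat n n \<Longrightarrow> shift_prod A es \<in> carrier_mat n n"
  by (induction es) (auto simp: shift_prod_simps intro!: mult_carrier_mat[of _ n n])

lemma char_matrix_mult_vec:
  assumes "A \<in> carrier_mat n n" "v \<in> carrier_vec n"
  shows "char_matrix A e *\<^sub>v v = A *\<^sub>v v - e \<cdot>\<^sub>v v"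
  using assms unfolding char_matrix_def
  by (intro eq_vecI) (auto simp: add_mult_distrib_mat_vec[of _ n n])

lemma mult_char_matrix:
  assumes A: "A \<in> carrier_mat n n" and B: "B \<in> carrier_mat n n" and eq: "B * A = \<theta> \<cdot>\<^sub>m B"
  shows "B * char_matrix A e = (\<theta> - e) \<cdot>\<^sub>m B"
proof -
  have "B * char_matrix A e = B * A + B * ((- e) \<cdot>\<^sub>m 1\<^sub>m n)"
    unfolding char_matrix_def using A B by (simp add: mult_add_distrib_mat[of _ n n _ n])
  also have "B * ((- e) \<cdot>\<^sub>m 1\<^sub>m n) = (- e) \<cdot>\<^sub>m B"
    using B mult_smult_distrib[OF B, of "1\<^sub>m n" n "- e"] by simp
  finally show ?thesis unfolding eq by (intro eq_matI) (use B in \<open>auto simp: algebra_simps\<close>)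
qed

lemma mult_shift_prod:
  assumes A: "A \<in> carrier_mat n n" and B: "B \<in> carrier_mat n n" and eq: "B * A = \<theta> \<cdot>\<^sub>m B"
  shows "B * shift_prod A es = (\<Prod>e\<leftarrow>es. \<theta> - e) \<cdot>\<^sub>m B"
proof (induction es)
  case Nil
  show ?case using A B by (simp add: shift_prod_simps) (auto intro!: eq_matI)
next
  case (Cons e es)
  have "B * (char_matrix A e * shift_prod A es) = (B * char_matrix A e) * shift_prod A es"
    by (rule assoc_mult_mat[OF B char_matrix_closed[OF A] shift_prod_carrier[OF A], symmetric])
  also have "\<dots> = (\<theta> - e) \<cdot>\<^sub>m (B * shift_prod A es)"
    unfolding mult_char_matrix[OF assms] using mult_smult_assoc_mat[OF B shift_prod_carrier[OF A]] by simp
  finally show ?case unfolding Cons by (simp add: shift_prod_simps smult_smult_mat)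
qed

lemma shift_prod_append:
  assumes "A \<in> carrier_mat n n"
  shows "shift_prod A (es @ fs) = shift_prod A es * shift_prod A fs"
proof (induction es)
  case Nil
  show ?case using assms shift_prod_carrier[OF assms, of fs] by (simp add: shift_prod_simps)
next
  case (Cons e es)
  then show ?case
    using assoc_mult_mat[OF char_matrix_closed[OF assms] shift_prod_carrier[OF assms] shift_prod_carrier[OF assms]]
    by (simp add: shift_prod_simps)
qed

text \<open>If the coordinates of \<open>x\<close> vanish from \<open>Suc k\<close> on, then
  subtracting the diagonal entry at \<open>k\<close> from \<open>B\<close> gives a matrix that maps
  \<open>x\<close> to a vector whose coordinates vanish from \<open>k\<close> on.\<close>

lemma shift_prod_upper_triangular:
  assumes B: "B \<in> carrier_mat n n" and ut: "upper_triangular B" and k: "k \<le> n"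
    and x: "x \<in> carrier_vec n" "\<And>i. k \<le> i \<Longrightarrow> i < n \<Longrightarrow> x $ i = 0"
  shows "shift_prod B (map (\<lambda>i. B $$ (i, i)) [0..<k]) *\<^sub>v x = 0\<^sub>v n"
  using k x
proof (induction k arbitrary: x)
  case 0
  have "x = 0\<^sub>v n" using 0 by (intro eq_vecI) auto
  then show ?case using B by (simp add: shift_prod_simps)
next
  case (Suc k)
  define y where "y = char_matrix B (B $$ (k, k)) *\<^sub>v x"
  have C: "char_matrix B (B $$ (k, k)) \<in> carrier_mat n n" using B by simp
  have y: "y \<in> carrier_vec n" using C Suc.prems by (simp add: y_def)
  have "y $ i = 0" if i: "k \<le> i" "i < n" for i
  proof -
    have "y $ i = (\<Sum>j<n. B $$ (i, j) * x $ j) - B $$ (k, k) * x $ i"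
      unfolding y_def char_matrix_mult_vec[OF B Suc.prems(2)] using B Suc.prems(2) i
      by (auto simp: scalar_prod_def lessThan_atLeast0)
    also have "(\<Sum>j<n. B $$ (i, j) * x $ j) = (\<Sum>j<n. if j = k then B $$ (i, k) * x $ k else 0)"
    proof (rule sum.cong[OF refl])
      fix j assume "j \<in> {..<n}"
      then have j: "j < n" by simp
      consider "j < k" | "j = k" | "j > k" by linarith
      then show "B $$ (i, j) * x $ j = (if j = k then B $$ (i, k) * x $ k else 0)"
      proof cases
        case 1
        then show ?thesis using ut B i by (auto simp: upper_triangular_def)
      next
        case 3
        then show ?thesis using Suc.prems(3)[of j] j by simp
      qed auto
    qed
    also have "\<dots> = B $$ (i, k) * x $ k" using Suc.prems(1) by simp
    finally have yi: "y $ i = B $$ (i, k) * x $ k - B $$ (k, k) * x $ i" .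
    show ?thesis
    proof (cases "i = k")
      case False
      then have "k < i" using i by simp
      then have "B $$ (i, k) = 0" "x $ i = 0"
        using ut B i Suc.prems(3)[of i] by (auto simp: upper_triangular_def)
      then show ?thesis using yi by simp
    qed (use yi in simp)
  qed
  then have IH: "shift_prod B (map (\<lambda>i. B $$ (i, i)) [0..<k]) *\<^sub>v y = 0\<^sub>v n"
    using Suc.prems(1) y by (intro Suc.IH) auto
  have "shift_prod B (map (\<lambda>i. B $$ (i, i)) [0..<Suc k])
      = shift_prod B (map (\<lambda>i. B $$ (i, i)) [0..<k]) * char_matrix B (B $$ (k, k))"
    using B right_mult_one_mat[OF C] by (simp add: shift_prod_append[OF B] shift_prod_simps)
  then show ?case using IH Suc.prems(2) assoc_mult_mat_vec[OF shift_prod_carrier[OF B] C]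
    by (simp add: y_def)
qed

text \<open>By Schur decomposition it suffices to consider an upper triangular matrix, which is
  annihilated by the product over its diagonal.\<close>

lemma shift_prod_annihilates:
  assumes A: "A \<in> carrier_mat n n"
  obtains es where "shift_prod A es = 0\<^sub>m n n"
proof -
  obtain as where as: "char_poly A = (\<Prod>a\<leftarrow>as. [:- a, 1:])" using char_poly_factorized[OF A] by blast
  obtain B where B: "B \<in> carrier_mat n n" "upper_triangular B" "similar_mat A B"
    using schur_decomposition_exists[OF A as] by blast
  obtain P Q where PQ: "similar_mat_wit A B P Q" using B(3) unfolding similar_mat_def by blast
  note w = similar_mat_witD2[OF A PQ]
  have AP: "A * P = P * B"
  proof -
    have "A * P = P * B * (Q * P)" unfolding w(3) using w by (simp add: assoc_mult_mat[of _ n n _ n _ n])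
    then show ?thesis using w B(1) by simp
  qed
  have CP: "char_matrix A e * P = P * char_matrix B e" for e
  proof -
    have "char_matrix A e * P = A * P + (- e) \<cdot>\<^sub>m P"
      unfolding char_matrix_def using A w(6)
      by (simp add: add_mult_distrib_mat[of _ n n _ _ n] mult_smult_assoc_mat[of _ n n _ n])
    also have "\<dots> = P * char_matrix B e"
      unfolding char_matrix_def AP using B(1) w(6)
      by (simp add: mult_add_distrib_mat[of _ n n _ n] mult_smult_distrib[of _ n n _ n])
    finally show ?thesis .
  qed
  have SP: "shift_prod A es * P = P * shift_prod B es" for es
  proof (induction es)
    case Nil
    show ?case using A B(1) w(6) by (simp add: shift_prod_simps)
  next
    case (Cons e es)
    note c = shift_prod_carrier[OF A, of es] shift_prod_carrier[OF B(1), of es]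
    have "shift_prod A (e # es) * P = char_matrix A e * (P * shift_prod B es)"
      unfolding shift_prod_simps Cons[symmetric] by (rule assoc_mult_mat[OF char_matrix_closed[OF A] c(1) w(6)])
    also have "\<dots> = (char_matrix A e * P) * shift_prod B es"
      by (rule assoc_mult_mat[OF char_matrix_closed[OF A] w(6) c(2), symmetric])
    also have "\<dots> = P * shift_prod B (e # es)"
      unfolding CP shift_prod_simps by (rule assoc_mult_mat[OF w(6) char_matrix_closed[OF B(1)] c(2)])
    finally show ?case .
  qed
  define es where "es = map (\<lambda>i. B $$ (i, i)) [0..<n]"
  note c = shift_prod_carrier[OF A, of es] shift_prod_carrier[OF B(1), of es]
  have "shift_prod B es = 0\<^sub>m n n"
    by (rule mat_eqI_mult_vec[OF c(2)])
       (use shift_prod_upper_triangular[OF B(1,2) order.refl] in \<open>auto simp: es_def\<close>)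
  then have "shift_prod A es * P = 0\<^sub>m n n" using SP w(6) by simp
  then have "shift_prod A es * P * Q = 0\<^sub>m n n" using w(7) by simp
  then have "shift_prod A es = 0\<^sub>m n n"
    using c(1) w by (simp add: assoc_mult_mat[of _ n n _ n _ n])
  then show ?thesis by (rule that)
qed

lemma eigenprojection_fixes:
  assumes A: "A \<in> carrier_mat n n" and v: "v \<in> eigenspace A \<theta>"
  shows "eigenprojection A \<theta> *\<^sub>v v = v"
proof (rule eigenprojection_eqI[OF A _ v])
  show v: "v \<in> carrier_vec n" using v eigenspace_subset_carrier[OF A] by auto
  fix u assume "u \<in> eigenspace A \<theta>"
  then have "u \<in> carrier_vec n" using eigenspace_subset_carrier[OF A] by auto
  then show "(v - v) \<bullet>c u = 0" using v by simp
qed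

text \<open>Completeness of the eigenspaces. Some product of shifts annihilates \<open>v\<close>. If
  \<open>A - e\<close> is the leftmost factor, the remaining product maps \<open>v\<close> to a
  vector \<open>w\<close> of the eigenspace of \<open>e\<close>. The projection to this eigenspace
  fixes \<open>w\<close>, but it turns the shifts into scalars and so sends \<open>w\<close> to a
  multiple of the projection of \<open>v\<close>, which is zero. Thus \<open>w = 0\<close>, and the
  factor can be dropped.\<close>

lemma eigenprojections_separate:
  assumes A: "A \<in> carrier_mat n n" and herm: "hermitian_mat A" and v: "v \<in> carrier_vec n"
    and zero: "\<And>\<theta>. eigenprojection A \<theta> *\<^sub>v v = 0\<^sub>v n"
  shows "v = 0\<^sub>v n"
proof -
  have "shift_prod A es *\<^sub>v v = 0\<^sub>v n \<Longrightarrow> v = 0\<^sub>v n" for es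
  proof (induction es)
    case Nil
    then show ?case using A v by (simp add: shift_prod_simps)
  next
    case (Cons e es)
    note c = shift_prod_carrier[OF A, of es]
    define w where "w = shift_prod A es *\<^sub>v v"
    have w: "w \<in> carrier_vec n" using c v by (simp add: w_def)
    have "char_matrix A e *\<^sub>v w = 0\<^sub>v n"
      using Cons.prems assoc_mult_mat_vec[OF char_matrix_closed[OF A] c v] by (simp add: shift_prod_simps w_def)
    then have 0: "A *\<^sub>v w - e \<cdot>\<^sub>v w = 0\<^sub>v n" using char_matrix_mult_vec[OF A w] by simp
    have "A *\<^sub>v w = e \<cdot>\<^sub>v w"
    proof (rule eq_vecI)
      fix i assume "i < dim_vec (e \<cdot>\<^sub>v w)"
      then have i: "i < n" using w by simp
      have "(A *\<^sub>v w - e \<cdot>\<^sub>v w) $ i = 0" using 0 i by simp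
      then show "(A *\<^sub>v w) $ i = (e \<cdot>\<^sub>v w) $ i" using i w A by (simp del: index_mult_mat_vec)
    qed (use A w in auto)
    then have "w \<in> eigenspace A e" using A w by (simp add: eigenspace_def)
    then have "w = eigenprojection A e *\<^sub>v w" by (rule eigenprojection_fixes[OF A, symmetric])
    also have "\<dots> = (eigenprojection A e * shift_prod A es) *\<^sub>v v"
      unfolding w_def using eigenprojection_carrier[OF A] c v by (rule assoc_mult_mat_vec[symmetric])
    also have "\<dots> = (\<Prod>f\<leftarrow>es. e - f) \<cdot>\<^sub>v (eigenprojection A e *\<^sub>v v)"
      unfolding mult_shift_prod[OF A eigenprojection_carrier[OF A] eigenprojection_mult_mat[OF A herm]]
      using eigenprojection_carrier[OF A, of e] v by (intro eq_vecI) auto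
    also have "\<dots> = 0\<^sub>v n" unfolding zero by (intro eq_vecI) auto
    finally show ?case using Cons.IH by (simp add: w_def)
  qed
  moreover obtain es where "shift_prod A es = 0\<^sub>m n n" using shift_prod_annihilates[OF A] .
  then have "shift_prod A es *\<^sub>v v = 0\<^sub>v n" using zero_mat_mult_vec[OF v] by simp
  ultimately show ?thesis .
qed

text \<open>The minimal polynomial of a Hermitian matrix has simple roots: the projection to an
  eigenspace turns the product of the shifts into a scalar, one factor of which is zero, and the
  eigenspaces are complete by the preceding lemma.\<close>

lemma hermitian_minimal_polynomial:
  assumes A: "A \<in> carrier_mat n n" and herm: "hermitian_mat A" and es: "Collect (eigenvalue A) \<subseteq> set es"
  shows "shift_prod A es = 0\<^sub>m n n"
proof (rule mat_eqI_mult_vec[OF shift_prod_carrier[OF A]])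
  fix v :: "complex vec" assume v: "v \<in> carrier_vec n"
  note c = shift_prod_carrier[OF A, of es]
  have "shift_prod A es *\<^sub>v v = 0\<^sub>v n"
  proof (rule eigenprojections_separate[OF A herm])
    show "shift_prod A es *\<^sub>v v \<in> carrier_vec n" using c v by simp
    fix \<theta>
    note E = eigenprojection_carrier[OF A, of \<theta>]
    have "eigenprojection A \<theta> *\<^sub>v (shift_prod A es *\<^sub>v v) = (eigenprojection A \<theta> * shift_prod A es) *\<^sub>v v"
      using E c v by (rule assoc_mult_mat_vec[symmetric])
    also have "\<dots> = (\<Prod>f\<leftarrow>es. \<theta> - f) \<cdot>\<^sub>v (eigenprojection A \<theta> *\<^sub>v v)"
      unfolding mult_shift_prod[OF A E eigenprojection_mult_mat[OF A herm]]
      using E v by (intro eq_vecI) auto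
    also have "\<dots> = 0\<^sub>v n"
    proof (cases "eigenvalue A \<theta>")
      case True
      then have "(\<Prod>f\<leftarrow>es. \<theta> - f) = 0" using es by (auto simp: prod_list_zero_iff)
      then show ?thesis using E v by auto
    next
      case False
      have "eigenprojection A \<theta> *\<^sub>v v \<in> eigenspace A \<theta>"
        using is_orthogonal_projection_eigenprojection[OF A, of \<theta>] v by (simp add: is_orthogonal_projection_def)
      then have "eigenprojection A \<theta> *\<^sub>v v = 0\<^sub>v n"
        using False A unfolding eigenvalue_def eigenvector_def eigenspace_def by auto
      then show ?thesis by (intro eq_vecI) auto
    qed
    finally show "eigenprojection A \<theta> *\<^sub>v (shift_prod A es *\<^sub>v v) = 0\<^sub>v n" .
  qed
  then show "shift_prod A es *\<^sub>v v = 0\<^sub>m n n *\<^sub>v v" using zero_mat_mult_vec[OF v] by simp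
qed simp

section \<open>Algebraicity of eigenprojections\<close>

lemma algebraic_mat_entry:
  "algebraic_mat M \<Longrightarrow> M \<in> carrier_mat n n \<Longrightarrow> i < n \<Longrightarrow> j < n \<Longrightarrow> algebraic (M $$ (i, j))"
  by (auto simp: algebraic_mat_def)

lemma algebraic_mat_mult:
  assumes "A \<in> carrier_mat n n" "B \<in> carrier_mat n n" "algebraic_mat A" "algebraic_mat B"
  shows "algebraic_mat (A * B)"
  using assms unfolding algebraic_mat_def
  by (auto simp: scalar_prod_def intro!: algebraic_sum_complex algebraic_mult_complex)

lemma algebraic_mat_eigenvalue:
  assumes A: "A \<in> carrier_mat n n" and alg: "algebraic_mat A" and ev: "eigenvalue A \<theta>"
  shows "algebraic \<theta>"
  using algebraic_eigenvalue[OF A algebraic_mat_entry[OF alg A] ev] .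

lemma algebraic_shift_prod:
  assumes A: "A \<in> carrier_mat n n" and alg: "algebraic_mat A" and es: "\<And>e. e \<in> set es \<Longrightarrow> algebraic e"
  shows "algebraic_mat (shift_prod A es)"
  using es
proof (induction es)
  case Nil
  then show ?case using A by (auto simp: shift_prod_simps algebraic_mat_def)
next
  case (Cons e es)
  have "algebraic (char_matrix A e $$ (i, j))" if ij: "i < n" "j < n" for i j
  proof -
    have "char_matrix A e $$ (i, j) = A $$ (i, j) - (if i = j then e else 0)"
      using A ij by (simp add: char_matrix_def)
    then show ?thesis
      using A alg ij Cons.prems[of e] by (auto simp: algebraic_mat_def intro!: algebraic_diff_complex)
  qed
  then have "algebraic_mat (char_matrix A e)"
    using char_matrix_closed[OF A, of e] unfolding algebraic_mat_def by auto
  then show ?case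
    using Cons algebraic_mat_mult[OF char_matrix_closed[OF A] shift_prod_carrier[OF A]]
    by (simp add: shift_prod_simps)
qed

text \<open>Lagrange interpolation: the product of \<open>A - e\<close> over the eigenvalues
  \<open>e\<close> other than \<open>\<theta>\<close> is a nonzero algebraic multiple of the
  eigenprojection. Its columns lie in the eigenspace of \<open>\<theta>\<close> because the product
  over all eigenvalues is zero.\<close>

theorem algebraic_eigenprojection:
  assumes A: "A \<in> carrier_mat n n" and herm: "hermitian_mat A" and alg: "algebraic_mat A"
    and ev: "eigenvalue A \<theta>"
  shows "algebraic_mat (eigenprojection A \<theta>)"
proof -
  let ?E = "eigenprojection A \<theta>"
  note E = eigenprojection_carrier[OF A, of \<theta>]
  have "finite (Collect (eigenvalue A) - {\<theta>})"
    using card_finite_spectrum(1)[OF A] by (simp add: spectrum_def)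
  then obtain es where es: "set es = Collect (eigenvalue A) - {\<theta>}" using finite_list by blast
  define c where "c = (\<Prod>e\<leftarrow>es. \<theta> - e)"
  have "\<theta> \<notin> set es" by (simp add: es)
  then have c0: "c \<noteq> 0" unfolding c_def prod_list_zero_iff by auto
  note S = shift_prod_carrier[OF A, of es]
  have alg_ev: "algebraic e" if "eigenvalue A e" for e
    using algebraic_mat_eigenvalue[OF A alg that] .
  have EP: "?E * shift_prod A es = c \<cdot>\<^sub>m ?E"
    unfolding c_def by (rule mult_shift_prod[OF A E eigenprojection_mult_mat[OF A herm]])
  have zero: "shift_prod A (\<theta> # es) = 0\<^sub>m n n"
    by (rule hermitian_minimal_polynomial[OF A herm]) (use es in auto)
  have "?E * shift_prod A es = shift_prod A es"
  proof (rule mat_eqI_mult_vec[of _ n])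
    fix v :: "complex vec" assume v: "v \<in> carrier_vec n"
    define w where "w = shift_prod A es *\<^sub>v v"
    have w: "w \<in> carrier_vec n" using S v by (simp add: w_def)
    have "char_matrix A \<theta> *\<^sub>v w = shift_prod A (\<theta> # es) *\<^sub>v v"
      unfolding w_def shift_prod_simps by (rule assoc_mult_mat_vec[OF char_matrix_closed[OF A] S v, symmetric])
    also have "\<dots> = 0\<^sub>v n" unfolding zero by (rule zero_mat_mult_vec[OF v])
    finally have 0: "A *\<^sub>v w - \<theta> \<cdot>\<^sub>v w = 0\<^sub>v n" using char_matrix_mult_vec[OF A w] by simp
    have "A *\<^sub>v w = \<theta> \<cdot>\<^sub>v w"
    proof (rule eq_vecI)
      fix i assume "i < dim_vec (\<theta> \<cdot>\<^sub>v w)"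
      then have i: "i < n" using w by simp
      have "(A *\<^sub>v w - \<theta> \<cdot>\<^sub>v w) $ i = 0" using 0 i by simp
      then show "(A *\<^sub>v w) $ i = (\<theta> \<cdot>\<^sub>v w) $ i" using i w A by (simp del: index_mult_mat_vec)
    qed (use A w in auto)
    then have "w \<in> eigenspace A \<theta>" using A w by (simp add: eigenspace_def)
    then have "?E *\<^sub>v w = w" by (rule eigenprojection_fixes[OF A])
    then show "(?E * shift_prod A es) *\<^sub>v v = shift_prod A es *\<^sub>v v"
      unfolding w_def using assoc_mult_mat_vec[OF E S v] by simp
  qed (use E S in auto)
  then have eq: "shift_prod A es = c \<cdot>\<^sub>m ?E" using EP by simp
  have "algebraic_mat (shift_prod A es)"
    by (rule algebraic_shift_prod[OF A alg]) (use es alg_ev in auto)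
  then have "algebraic (c * ?E $$ (i, j))" if "i < n" "j < n" for i j
    using E that unfolding eq algebraic_mat_def by auto
  moreover have "algebraic c"
  proof -
    have "algebraic (\<Prod>e\<leftarrow>fs. \<theta> - e)" if "set fs \<subseteq> set es" for fs
      using that
    proof (induction fs)
      case Nil
      show ?case by (simp add: rat_imp_algebraic)
    next
      case (Cons f fs)
      then show ?case using alg_ev ev es by (auto intro!: algebraic_mult_complex algebraic_diff_complex)
    qed
    then show ?thesis by (simp add: c_def)
  qed
  ultimately have "algebraic (?E $$ (i, j))" if "i < n" "j < n" for i j
    using algebraic_divide_complex[of "c * ?E $$ (i, j)" c] c0 that by simp
  then show ?thesis using E by (auto simp: algebraic_mat_def)
qed

section \<open>The ratio condition\<close>

text \<open>The phase is a quotient of corresponding entries of two algebraic matrices.\<close>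

theorem algebraic_phase:
  assumes A: "A \<in> carrier_mat n n" "hermitian_mat A" "algebraic_mat A"
    and D: "D \<in> carrier_mat n n" "algebraic_mat D" "algebraic_mat (state_at A D t)"
    and supp: "(\<theta>, \<eta>) \<in> eigenvalue_support A D"
  shows "algebraic (exp (\<i> * of_real t * (\<theta> - \<eta>)))"
proof -
  let ?E = "eigenprojection A \<theta>" and ?F = "eigenprojection A \<eta>"
  let ?M = "?E * D * ?F" and ?N = "?E * state_at A D t * ?F"
  have ev: "eigenvalue A \<theta>" "eigenvalue A \<eta>" and nz: "?M \<noteq> 0\<^sub>m n n"
    using supp A(1) by (auto simp: eigenvalue_support_def)
  note E = eigenprojection_carrier[OF A(1), of \<theta>] and F = eigenprojection_carrier[OF A(1), of \<eta>]
  have S: "state_at A D t \<in> carrier_mat n n"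
    using A(1) D(1) by (auto simp: state_at_def transition_mat_def mat_exp_def)
  have algEF: "algebraic_mat ?E" "algebraic_mat ?F"
    using algebraic_eigenprojection[OF A] ev by auto
  have alg: "algebraic_mat ?M" "algebraic_mat ?N"
    using algebraic_mat_mult[OF mult_carrier_mat[OF E D(1)] F algebraic_mat_mult[OF E D(1) algEF(1) D(2)] algEF(2)]
      algebraic_mat_mult[OF mult_carrier_mat[OF E S] F algebraic_mat_mult[OF E S algEF(1) D(3)] algEF(2)]
    by auto
  have M: "?M \<in> carrier_mat n n" and N: "?N \<in> carrier_mat n n"
    using mult_carrier_mat[OF mult_carrier_mat[OF E D(1)] F] mult_carrier_mat[OF mult_carrier_mat[OF E S] F] .
  have "\<exists>i j. i < n \<and> j < n \<and> ?M $$ (i, j) \<noteq> 0"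
  proof (rule ccontr)
    assume "\<not> ?thesis"
    then have "?M = 0\<^sub>m n n" using M by (intro eq_matI) (auto simp del: index_mult_mat)
    then show False using nz by simp
  qed
  then obtain i j where ij: "i < n" "j < n" "?M $$ (i, j) \<noteq> 0" by blast
  have "?N $$ (i, j) = exp (\<i> * of_real t * (\<theta> - \<eta>)) * ?M $$ (i, j)"
    unfolding eigenprojection_state_at[OF A(1,2) D(1)]
    by (rule index_smult_mat(1)) (use carrier_matD[OF M] ij in simp_all)
  then have "exp (\<i> * of_real t * (\<theta> - \<eta>)) = ?N $$ (i, j) / ?M $$ (i, j)"
    using ij(3) by simp
  also have "algebraic \<dots>"
    by (intro algebraic_divide_complex algebraic_mat_entry[OF alg(1) M] algebraic_mat_entry[OF alg(2) N] ij)
  finally show ?thesis .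
qed

theorem theorem6p1:
  fixes A D :: "complex mat" and n :: nat and t :: real
  assumes "A \<in> carrier_mat n n" and "hermitian_mat A" and "algebraic_mat A"
    and "D \<in> carrier_mat n n" and "density_mat D" and "algebraic_mat D"
    and "t \<noteq> 0" and "algebraic_mat (state_at A D t)"
  shows "ratio_condition (eigenvalue_support A D)"
proof -
  have "(\<theta>\<^sub>r - \<theta>\<^sub>s) / (\<theta>\<^sub>k - \<theta>\<^sub>l) \<in> \<rat>"
    if supp: "(\<theta>\<^sub>r, \<theta>\<^sub>s) \<in> eigenvalue_support A D" "(\<theta>\<^sub>k, \<theta>\<^sub>l) \<in> eigenvalue_support A D"
      and ne: "\<theta>\<^sub>k \<noteq> \<theta>\<^sub>l"
    for \<theta>\<^sub>r \<theta>\<^sub>s \<theta>\<^sub>k \<theta>\<^sub>l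
  proof (rule gelfond_schneider)
    have "eigenvalue A \<theta>\<^sub>r" "eigenvalue A \<theta>\<^sub>s" "eigenvalue A \<theta>\<^sub>k" "eigenvalue A \<theta>\<^sub>l"
      using supp by (simp_all add: eigenvalue_support_def)
    then have "algebraic \<theta>\<^sub>r" "algebraic \<theta>\<^sub>s" "algebraic \<theta>\<^sub>k" "algebraic \<theta>\<^sub>l"
      by (simp_all only: algebraic_mat_eigenvalue[OF assms(1,3)])
    then show "algebraic ((\<theta>\<^sub>r - \<theta>\<^sub>s) / (\<theta>\<^sub>k - \<theta>\<^sub>l))"
      by (intro algebraic_divide_complex algebraic_diff_complex)
    note phase = algebraic_phase[OF assms(1-4,6,8)]
    show "algebraic (exp (\<i> * of_real t * (\<theta>\<^sub>k - \<theta>\<^sub>l)))" by (rule phase[OF supp(2)])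
    show "algebraic (exp (\<i> * of_real t * (\<theta>\<^sub>k - \<theta>\<^sub>l) * ((\<theta>\<^sub>r - \<theta>\<^sub>s) / (\<theta>\<^sub>k - \<theta>\<^sub>l))))"
      using phase[OF supp(1)] ne by (simp add: mult.assoc)
    show "\<i> * of_real t * (\<theta>\<^sub>k - \<theta>\<^sub>l) \<noteq> 0" using assms(7) ne by simp
  qed
  then show ?thesis by (auto simp: ratio_condition_def)
qed

end
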